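(* The following are pairwise equivalent over $\mathsf{RCA}_0$: (1) $\mathsf{ACA}_0$; (2) $\omega$ is embeddable; (3) $\omega^*$ is embeddable; (4) $\zeta$ is embeddable; (5) $\omega+\omega^*$ is embeddable.
   Context: $\mathsf{RCA}_0$ is the usual base system of reverse mathematics, a theory in the language of second-order arithmetic: the axioms of discretely ordered semirings for $\mathbb{N}$, induction for $\Sigma^0_1$ formulas, and comprehension for $\Delta^0_1$ predicates (formulas may contain number and set parameters). $\mathsf{ACA}_0$ is $\mathsf{RCA}_0$ plus comprehension for all arithmetical formulas. The following definitions are made in $\mathsf{RCA}_0$. A (countable) partial order is a set $P\subseteq\mathbb{N}$ with a set coding a partial order relation $\leq_P$ on $P$. A set $X$ is finite if $(\exists m)(\forall x\in X)(x<m)$. The partial order $P$ is: - $\omega$-like if every element of $P$ has finitely many predecessors; - $\omega^*$-like if every element of $P$ has finitely many successors; - $\omega+\omega^*$-like if every element of $P$ has finitely many predecessors or finitely many successors; - $\zeta$-like if for every pair of elements $x,y\in P$ there exist only finitely many $z\in P$ with $x<_P z<_P y$. The predecessors of $x$ are the $y$ with $y<_P x$, and the successors of $x$ are the $y$ with $x<_P y$. Canonical representatives of the order types: $\omega$ is $(\mathbb{N},\leq)$ and $\omega^*$ is $(\mathbb{N},\geq)$. For partial orders $P_0,P_1$, the sum $P_0+P_1$ is the set $\{(i,x): i<2,\ x\in P_i\}$ ordered by $(i,x)\leq(j,y)$ iff $i<j$, or $i=j$ and $x\leq_{P_i}y$. This defines $\omega+\omega^*$, and $\zeta=\omega^*+\omega$.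 For $\tau\in\{\omega,\omega^*,\zeta,\omega+\omega^*\}$, "$\tau$ is embeddable" is the statement that every $\tau$-like partial order $P$ embeds into $\tau$, that is, there exists a one-to-one map $h$ from $P$ to $\tau$ which is order preserving: $x\leq_P y$ implies $h(x)\leq_\tau h(y)$. *)

theory Defs
  imports Main
begin

text \<open>
  Reverse mathematics over the formal system RCA$_0$ is rendered semantically, through all (possibly
  nonstandard) Henkin models of second-order arithmetic. Such a model consists of a first-order part,
  which is the whole of a type \<open>'a\<close> of the class below, and of a nonempty collection
  \<open>S :: 'a set set\<close> over which the set quantifiers range. Equality of sets is coextensionality, so
  sets of the model can be taken to be actual subsets of the first-order part.
\<close>

text \<open>
  Discretely ordered semirings (the axioms PA$^-$): commutative semirings with a compatible discrete
  linear order in which \<open>a \<le> b\<close> holds iff \<open>b = a + c\<close> for some \<open>c\<close>; in particular \<open>0\<close> is the least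
  element. The subtraction inherited from the library class is not a symbol of the language below.
  It is harmless, since every such semiring can be expanded by truncated subtraction.
\<close>

class discretely_ordered_semiring = discrete_linordered_semidom + canonically_ordered_monoid_add

subsection \<open>The language of second-order arithmetic\<close>

datatype tm = Var nat | Zero | One | Add tm tm | Mult tm tm

text \<open>Number variables and set variables are named independently, each by natural numbers.\<close>

datatype fm =
    Eq tm tm | Less tm tm | Mem tm nat
  | Neg fm | Conj fm fm | Disj fm fm | Impl fm fm
  | AllN nat fm | ExN nat fm
  | AllS nat fm | ExS nat fm

primrec tm_vars :: "tm \<Rightarrow> nat set" where
  "tm_vars (Var n) = {n}"
| "tm_vars Zero = {}"
| "tm_vars One = {}"
| "tm_vars (Add t u) = tm_vars t \<union> tm_vars u"
| "tm_vars (Mult t u) = tm_vars t \<union> tm_vars u"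

primrec tm_val :: "(nat \<Rightarrow> 'a::discretely_ordered_semiring) \<Rightarrow> tm \<Rightarrow> 'a" where
  "tm_val e (Var n) = e n"
| "tm_val e Zero = 0"
| "tm_val e One = 1"
| "tm_val e (Add t u) = tm_val e t + tm_val e u"
| "tm_val e (Mult t u) = tm_val e t * tm_val e u"

primrec sat :: "'a::discretely_ordered_semiring set set \<Rightarrow> (nat \<Rightarrow> 'a) \<Rightarrow> (nat \<Rightarrow> 'a set) \<Rightarrow> fm \<Rightarrow> bool"
where
  "sat S e s (Eq t u) \<longleftrightarrow> tm_val e t = tm_val e u"
| "sat S e s (Less t u) \<longleftrightarrow> tm_val e t < tm_val e u"
| "sat S e s (Mem t X) \<longleftrightarrow> tm_val e t \<in> s X"
| "sat S e s (Neg p) \<longleftrightarrow> \<not> sat S e s p"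
| "sat S e s (Conj p q) \<longleftrightarrow> sat S e s p \<and> sat S e s q"
| "sat S e s (Disj p q) \<longleftrightarrow> sat S e s p \<or> sat S e s q"
| "sat S e s (Impl p q) \<longleftrightarrow> (sat S e s p \<longrightarrow> sat S e s q)"
| "sat S e s (AllN x p) \<longleftrightarrow> (\<forall>a. sat S (e(x := a)) s p)"
| "sat S e s (ExN x p) \<longleftrightarrow> (\<exists>a. sat S (e(x := a)) s p)"
| "sat S e s (AllS X p) \<longleftrightarrow> (\<forall>A\<in>S. sat S e (s(X := A)) p)"
| "sat S e s (ExS X p) \<longleftrightarrow> (\<exists>A\<in>S. sat S e (s(X := A)) p)"

text \<open>The bounded formulas; the bounding term must not contain the quantified variable.\<close>

inductive bounded_fm :: "fm \<Rightarrow> bool" where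
  "bounded_fm (Eq t u)"
| "bounded_fm (Less t u)"
| "bounded_fm (Mem t X)"
| "bounded_fm p \<Longrightarrow> bounded_fm (Neg p)"
| "bounded_fm p \<Longrightarrow> bounded_fm q \<Longrightarrow> bounded_fm (Conj p q)"
| "bounded_fm p \<Longrightarrow> bounded_fm q \<Longrightarrow> bounded_fm (Disj p q)"
| "bounded_fm p \<Longrightarrow> bounded_fm q \<Longrightarrow> bounded_fm (Impl p q)"
| "bounded_fm p \<Longrightarrow> x \<notin> tm_vars t \<Longrightarrow> bounded_fm (AllN x (Impl (Less (Var x) t) p))"
| "bounded_fm p \<Longrightarrow> x \<notin> tm_vars t \<Longrightarrow> bounded_fm (ExN x (Conj (Less (Var x) t) p))"

definition Sigma01_fm :: "fm \<Rightarrow> bool" where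
  "Sigma01_fm p \<longleftrightarrow> (\<exists>x q. bounded_fm q \<and> p = ExN x q)"

definition Pi01_fm :: "fm \<Rightarrow> bool" where
  "Pi01_fm p \<longleftrightarrow> (\<exists>x q. bounded_fm q \<and> p = AllN x q)"

primrec arithmetical_fm :: "fm \<Rightarrow> bool" where
  "arithmetical_fm (Eq t u) \<longleftrightarrow> True"
| "arithmetical_fm (Less t u) \<longleftrightarrow> True"
| "arithmetical_fm (Mem t X) \<longleftrightarrow> True"
| "arithmetical_fm (Neg p) \<longleftrightarrow> arithmetical_fm p"
| "arithmetical_fm (Conj p q) \<longleftrightarrow> arithmetical_fm p \<and> arithmetical_fm q"
| "arithmetical_fm (Disj p q) \<longleftrightarrow> arithmetical_fm p \<and> arithmetical_fm q"
| "arithmetical_fm (Impl p q) \<longleftrightarrow> arithmetical_fm p \<and> arithmetical_fm q"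
| "arithmetical_fm (AllN x p) \<longleftrightarrow> arithmetical_fm p"
| "arithmetical_fm (ExN x p) \<longleftrightarrow> arithmetical_fm p"
| "arithmetical_fm (AllS X p) \<longleftrightarrow> False"
| "arithmetical_fm (ExS X p) \<longleftrightarrow> False"

subsection \<open>The axiom systems\<close>

text \<open>
  The assignments \<open>e\<close> and \<open>s\<close> supply the number and set parameters. The set asserted to exist by a
  comprehension axiom is not the value of any set variable, so no freshness condition is needed.
\<close>

definition Sigma01_induction :: "'a::discretely_ordered_semiring set set \<Rightarrow> bool" where
  "Sigma01_induction S \<longleftrightarrow>
    (\<forall>p x e s. Sigma01_fm p \<and> range s \<subseteq> S \<and>
       sat S (e(x := 0)) s p \<and>
       (\<forall>n. sat S (e(x := n)) s p \<longrightarrow> sat S (e(x := n + 1)) s p)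
       \<longrightarrow> (\<forall>n. sat S (e(x := n)) s p))"

definition Delta01_comprehension :: "'a::discretely_ordered_semiring set set \<Rightarrow> bool" where
  "Delta01_comprehension S \<longleftrightarrow>
    (\<forall>p q x e s. Sigma01_fm p \<and> Pi01_fm q \<and> range s \<subseteq> S \<and>
       (\<forall>n. sat S (e(x := n)) s p \<longleftrightarrow> sat S (e(x := n)) s q)
       \<longrightarrow> {n. sat S (e(x := n)) s p} \<in> S)"

definition arithmetical_comprehension :: "'a::discretely_ordered_semiring set set \<Rightarrow> bool" where
  "arithmetical_comprehension S \<longleftrightarrow>
    (\<forall>p x e s. arithmetical_fm p \<and> range s \<subseteq> S \<longrightarrow> {n. sat S (e(x := n)) s p} \<in> S)"

definition RCA0 :: "'a::discretely_ordered_semiring set set \<Rightarrow> bool" where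
  "RCA0 S \<longleftrightarrow> S \<noteq> {} \<and> Sigma01_induction S \<and> Delta01_comprehension S"

definition ACA0 :: "'a::discretely_ordered_semiring set set \<Rightarrow> bool" where
  "ACA0 S \<longleftrightarrow> RCA0 S \<and> arithmetical_comprehension S"

subsection \<open>Partial orders inside a model\<close>

text \<open>The usual injective coding of pairs; \<open>rel_of L\<close> is the relation coded by a set \<open>L\<close>.\<close>

definition cpair :: "'a::discretely_ordered_semiring \<Rightarrow> 'a \<Rightarrow> 'a" where
  "cpair x y = (x + y)\<^sup>2 + x"

definition rel_of :: "'a::discretely_ordered_semiring set \<Rightarrow> 'a rel" where
  "rel_of L = {(x, y). cpair x y \<in> L}"

text \<open>Finiteness in the sense of the model, which differs from \<open>finite\<close> in nonstandard models.\<close>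

definition fin :: "'a::discretely_ordered_semiring set \<Rightarrow> bool" where
  "fin X \<longleftrightarrow> (\<exists>m. \<forall>x\<in>X. x < m)"

text \<open>An order is given by its underlying set and its non-strict order relation.\<close>

type_synonym 'a po = "'a set \<times> 'a rel"

definition po_less :: "'a po \<Rightarrow> 'a \<Rightarrow> 'a \<Rightarrow> bool" where
  "po_less T x y \<longleftrightarrow> x \<in> fst T \<and> y \<in> fst T \<and> (x, y) \<in> snd T \<and> x \<noteq> y"

definition predecessors :: "'a po \<Rightarrow> 'a \<Rightarrow> 'a set" where
  "predecessors T x = {y. po_less T y x}"

definition successors :: "'a po \<Rightarrow> 'a \<Rightarrow> 'a set" where
  "successors T x = {y. po_less T x y}"

definition omega_like :: "'a::discretely_ordered_semiring po \<Rightarrow> bool" where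
  "omega_like T \<longleftrightarrow> (\<forall>x\<in>fst T. fin (predecessors T x))"

definition omega_star_like :: "'a::discretely_ordered_semiring po \<Rightarrow> bool" where
  "omega_star_like T \<longleftrightarrow> (\<forall>x\<in>fst T. fin (successors T x))"

definition omega_plus_omega_star_like :: "'a::discretely_ordered_semiring po \<Rightarrow> bool" where
  "omega_plus_omega_star_like T \<longleftrightarrow>
    (\<forall>x\<in>fst T. fin (predecessors T x) \<or> fin (successors T x))"

definition zeta_like :: "'a::discretely_ordered_semiring po \<Rightarrow> bool" where
  "zeta_like T \<longleftrightarrow> (\<forall>x\<in>fst T. \<forall>y\<in>fst T. fin {z. po_less T x z \<and> po_less T z y})"

definition omega :: "'a::discretely_ordered_semiring po" where
  "omega = (UNIV, {(x, y). x \<le> y})"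

definition omega_star :: "'a::discretely_ordered_semiring po" where
  "omega_star = (UNIV, {(x, y). y \<le> x})"

text \<open>The element \<open>(i, x)\<close> of a sum, where \<open>i\<close> is \<open>0\<close> or \<open>1\<close>, is represented by its code.\<close>

definition po_sum :: "'a::discretely_ordered_semiring po \<Rightarrow> 'a po \<Rightarrow> 'a po" where
  "po_sum T\<^sub>0 T\<^sub>1 =
    ({cpair 0 x | x. x \<in> fst T\<^sub>0} \<union> {cpair 1 x | x. x \<in> fst T\<^sub>1},
     {(cpair 0 x, cpair 1 y) | x y. x \<in> fst T\<^sub>0 \<and> y \<in> fst T\<^sub>1} \<union>
     {(cpair 0 x, cpair 0 y) | x y. x \<in> fst T\<^sub>0 \<and> y \<in> fst T\<^sub>0 \<and> (x, y) \<in> snd T\<^sub>0} \<union>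
     {(cpair 1 x, cpair 1 y) | x y. x \<in> fst T\<^sub>1 \<and> y \<in> fst T\<^sub>1 \<and> (x, y) \<in> snd T\<^sub>1})"

definition omega_plus_omega_star :: "'a::discretely_ordered_semiring po" where
  "omega_plus_omega_star = po_sum omega omega_star"

definition zeta :: "'a::discretely_ordered_semiring po" where
  "zeta = po_sum omega_star omega"

text \<open>
  The embedding must exist in the model: it is (the relation coded by) a set \<open>h \<in> S\<close> that is the
  graph of a one-to-one order-preserving function. Order reflection is not required.
\<close>

definition embeds_into :: "'a::discretely_ordered_semiring set set \<Rightarrow> 'a po \<Rightarrow> 'a po \<Rightarrow> bool" where
  "embeds_into S T U \<longleftrightarrow>
    (\<exists>h\<in>S. single_valued (rel_of h) \<and> Domain (rel_of h) = fst T \<and> Range (rel_of h) \<subseteq> fst U \<and>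
       single_valued ((rel_of h)\<inverse>) \<and>
       (\<forall>x y u v. (x, y) \<in> snd T \<and> (x, u) \<in> rel_of h \<and> (y, v) \<in> rel_of h \<longrightarrow> (u, v) \<in> snd U))"

definition embeddable ::
  "'a::discretely_ordered_semiring set set \<Rightarrow> ('a po \<Rightarrow> bool) \<Rightarrow> 'a po \<Rightarrow> bool" where
  "embeddable S like U \<longleftrightarrow>
    (\<forall>P\<in>S. \<forall>L\<in>S. partial_order_on P (rel_of L) \<and> like (P, rel_of L)
       \<longrightarrow> embeds_into S (P, rel_of L) U)"

definition omega_embeddable :: "'a::discretely_ordered_semiring set set \<Rightarrow> bool" where
  "omega_embeddable S \<longleftrightarrow> embeddable S omega_like omega"

definition omega_star_embeddable :: "'a::discretely_ordered_semiring set set \<Rightarrow> bool" where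
  "omega_star_embeddable S \<longleftrightarrow> embeddable S omega_star_like omega_star"

definition zeta_embeddable :: "'a::discretely_ordered_semiring set set \<Rightarrow> bool" where
  "zeta_embeddable S \<longleftrightarrow> embeddable S zeta_like zeta"

definition omega_plus_omega_star_embeddable :: "'a::discretely_ordered_semiring set set \<Rightarrow> bool" where
  "omega_plus_omega_star_embeddable S \<longleftrightarrow>
    embeddable S omega_plus_omega_star_like omega_plus_omega_star"

end

theory Submission
  imports Defs
begin

text \<open>
  The embedding statements imply arithmetical comprehension because an embedding bounds searches.
  Given a decidable relation \<open>R\<close>, take a point \<open>a\<^sub>n\<close> for each \<open>n\<close> and, if \<open>x\<close> is the least number
  with \<open>R n x\<close>, a chain of \<open>x + 1\<close> points below \<open>a\<^sub>n\<close>. The points of the chain are numbers that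
  are greater than \<open>x\<close>, so membership in the chain can be decided although the existence of \<open>x\<close>
  cannot, and the order is \<open>\<omega>\<close>-like. An embedding \<open>h\<close> into \<open>\<omega>\<close> is order preserving and
  one-to-one, hence \<open>x \<le> h(a\<^sub>n)\<close>, and \<open>\<exists>x. R n x\<close> becomes a bounded search
  (\<open>Sigma01_comprehension_if_omega_embeddable\<close>). Comprehension for \<open>\<Sigma>\<^sup>0\<^sub>1\<close> formulas removes one
  unbounded quantifier after another, which gives arithmetical comprehension
  (\<open>ACA0_iff_sigma01_model\<close>). The types \<open>\<omega>\<close> and \<open>\<omega>\<^sup>*\<close> are dual. To embed an \<open>\<omega>\<close>-like order
  into \<open>\<omega>\<close> when \<open>\<zeta>\<close> is embeddable, add a least element: everything then lands above its image in
  \<open>\<zeta>\<close>, and a final segment of \<open>\<zeta>\<close> is a copy of \<open>\<omega>\<close>. When \<open>\<omega> + \<omega>\<^sup>*\<close> is embeddable, multiply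
  the order by \<open>\<omega>\<close>: each point then has an infinite ascending chain above it and cannot land in
  the part \<open>\<omega>\<^sup>*\<close>.

  Conversely, assume arithmetical comprehension and let \<open>P\<close> be \<open>\<omega>\<close>-like
  (\<open>omega_embeddable\<close>). The down-sets of the points are finite and grow with the points, so it is
  enough to code finite sets by numbers in a one-to-one and monotone way. As in Goedel's
  \<open>\<beta>\<close>-function, let \<open>b\<close> be divisible by all small positive numbers; then the numbers
  \<open>1 + (i + 1) b\<close> are pairwise coprime for small \<open>i\<close>, and the least common multiple of those
  with \<open>i\<close> in a finite set is such a code. The number \<open>b\<close> depends on a bound \<open>N(x)\<close> of the down-set
  of \<open>x\<close>; points are therefore ordered by \<open>N(x)\<close> first and by the code second, which is the
  reason for the embedding \<open>N(x) R(N(x)) + code(x)\<close>, where \<open>R(n)\<close> bounds all codes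
  of points with \<open>N(x) \<le> n\<close>.

  For the remaining two types, the order is cut into an initial part and the rest, which are
  embedded separately (\<open>embeds_into_po_sum\<close>). In the \<open>\<omega> + \<omega>\<^sup>*\<close>-like case the initial part
  consists of the points with finitely many predecessors. In the \<open>\<zeta>\<close>-like case it consists of the
  points \<open>x\<close> such that the least number above \<open>x\<close> in the order is smaller than the least number
  below \<open>x\<close>; each part then has the right type because its initial or final segments lie in
  finite unions of intervals.
\<close>

section \<open>Definability by bounded formulas\<close>

text \<open>
  Comprehension and induction are given for formulas, but the constructions below are written as
  relations of the logic. This part provides rules by which the definability of a relation follows
  from the way in which it is written. A relation has its arguments in an assignment
  \<open>nat \<Rightarrow> 'a\<close>; quantifiers bind in the style of de Bruijn, so that no rule has a freshness condition.
\<close>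

primrec rename_tm :: "(nat \<Rightarrow> nat) \<Rightarrow> tm \<Rightarrow> tm" where
  "rename_tm \<rho> (Var n) = Var (\<rho> n)"
| "rename_tm \<rho> Zero = Zero"
| "rename_tm \<rho> One = One"
| "rename_tm \<rho> (Add t u) = Add (rename_tm \<rho> t) (rename_tm \<rho> u)"
| "rename_tm \<rho> (Mult t u) = Mult (rename_tm \<rho> t) (rename_tm \<rho> u)"

primrec rename_fm :: "(nat \<Rightarrow> nat) \<Rightarrow> (nat \<Rightarrow> nat) \<Rightarrow> fm \<Rightarrow> fm" where
  "rename_fm \<rho> \<sigma> (Eq t u) = Eq (rename_tm \<rho> t) (rename_tm \<rho> u)"
| "rename_fm \<rho> \<sigma> (Less t u) = Less (rename_tm \<rho> t) (rename_tm \<rho> u)"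
| "rename_fm \<rho> \<sigma> (Mem t X) = Mem (rename_tm \<rho> t) (\<sigma> X)"
| "rename_fm \<rho> \<sigma> (Neg p) = Neg (rename_fm \<rho> \<sigma> p)"
| "rename_fm \<rho> \<sigma> (Conj p q) = Conj (rename_fm \<rho> \<sigma> p) (rename_fm \<rho> \<sigma> q)"
| "rename_fm \<rho> \<sigma> (Disj p q) = Disj (rename_fm \<rho> \<sigma> p) (rename_fm \<rho> \<sigma> q)"
| "rename_fm \<rho> \<sigma> (Impl p q) = Impl (rename_fm \<rho> \<sigma> p) (rename_fm \<rho> \<sigma> q)"
| "rename_fm \<rho> \<sigma> (AllN x p) = AllN (\<rho> x) (rename_fm \<rho> \<sigma> p)"
| "rename_fm \<rho> \<sigma> (ExN x p) = ExN (\<rho> x) (rename_fm \<rho> \<sigma> p)"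
| "rename_fm \<rho> \<sigma> (AllS X p) = AllS (\<sigma> X) (rename_fm \<rho> \<sigma> p)"
| "rename_fm \<rho> \<sigma> (ExS X p) = ExS (\<sigma> X) (rename_fm \<rho> \<sigma> p)"

lemma tm_val_rename: "tm_val e (rename_tm \<rho> t) = tm_val (e \<circ> \<rho>) t"
  by (induction t) auto

lemma tm_vars_rename: "tm_vars (rename_tm \<rho> t) = \<rho> ` tm_vars t"
  by (induction t) auto

lemma fun_upd_comp_inj: "inj \<rho> \<Longrightarrow> e(\<rho> x := a) \<circ> \<rho> = (e \<circ> \<rho>)(x := a)"
  by (auto simp: fun_eq_iff inj_eq)

lemma sat_rename:
  assumes "inj \<rho>" "inj \<sigma>"
  shows "sat S e s (rename_fm \<rho> \<sigma> p) \<longleftrightarrow> sat S (e \<circ> \<rho>) (s \<circ> \<sigma>) p"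
  by (induction p arbitrary: e s) (simp_all add: tm_val_rename fun_upd_comp_inj assms)

lemma bounded_rename: "bounded_fm p \<Longrightarrow> inj \<rho> \<Longrightarrow> bounded_fm (rename_fm \<rho> \<sigma> p)"
  by (induction rule: bounded_fm.induct)
    (auto intro!: bounded_fm.intros simp: tm_vars_rename inj_eq)

lemma tm_val_cong: "(\<And>n. n \<in> tm_vars t \<Longrightarrow> e n = e' n) \<Longrightarrow> tm_val e t = tm_val e' t"
  by (induction t) auto

lemma finite_tm_vars: "finite (tm_vars t)"
  by (induction t) auto

lemma tm_vars_bounded: "\<exists>K. \<forall>n\<in>tm_vars t. n < K"
  using finite_tm_vars[of t] by (auto simp: finite_nat_set_iff_bounded)

lemma tm_finite_dependence:
  "\<exists>K. \<forall>e e'. (\<forall>n<K. e n = e' n) \<longrightarrow> tm_val e t = tm_val e' t"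
  by (meson tm_vars_bounded tm_val_cong)

lemma finite_dependence_conj:
  assumes "\<exists>K. \<forall>e e'. (\<forall>n<K. e n = e' n) \<longrightarrow> P e e'"
    and "\<exists>K. \<forall>e e'. (\<forall>n<K. e n = e' n) \<longrightarrow> Q e e'"
  shows "\<exists>K::nat. \<forall>e e' :: nat \<Rightarrow> 'b. (\<forall>n<K. e n = e' n) \<longrightarrow> P e e' \<and> Q e e'"
proof -
  obtain K L where K: "\<And>e e'. (\<forall>n<K. e n = e' n) \<Longrightarrow> P e e'"
    and L: "\<And>e e'. (\<forall>n<L. e n = e' n) \<Longrightarrow> Q e e'"
    using assms by blast
  show ?thesis
  proof (intro exI[of _ "max K L"] allI impI)
    fix e e' :: "nat \<Rightarrow> 'b" assume "\<forall>n<max K L. e n = e' n"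
    then have "\<forall>n<K. e n = e' n" "\<forall>n<L. e n = e' n" by simp_all
    then show "P e e' \<and> Q e e'" using K L by blast
  qed
qed

lemma finite_dependence_mono:
  assumes "\<exists>K. \<forall>e e'. (\<forall>n<K. e n = e' n) \<longrightarrow> P e e'"
    and "\<And>e e'. P e e' \<Longrightarrow> Q e e'"
  shows "\<exists>K::nat. \<forall>e e'. (\<forall>n<K. e n = e' n) \<longrightarrow> Q e e'"
  using assms by blast

text \<open>
  The formula mentions finitely many variables only. This yields fresh variables below, and it makes
  the elimination of quantifiers by pairing terminate.
\<close>

lemma sat_finite_dependence:
  "\<exists>K. \<forall>e e'. (\<forall>n<K. e n = e' n) \<longrightarrow> (\<forall>s. sat S e s p \<longleftrightarrow> sat S e' s p)"
proof (induction p)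
  case (Eq t u)
  show ?case
    by (rule finite_dependence_mono[OF finite_dependence_conj[
          OF tm_finite_dependence[of t] tm_finite_dependence[of u]]]) simp
next
  case (Less t u)
  show ?case
    by (rule finite_dependence_mono[OF finite_dependence_conj[
          OF tm_finite_dependence[of t] tm_finite_dependence[of u]]]) simp
next
  case (Mem t X)
  show ?case
    by (rule finite_dependence_mono[OF tm_finite_dependence[of t]]) simp
next
  case (AllN x p)
  then obtain K where
    K: "\<And>e e' s. (\<forall>n<K. e n = e' n) \<Longrightarrow> sat S e s p \<longleftrightarrow> sat S e' s p" by blast
  have "sat S (e(x := a)) s p \<longleftrightarrow> sat S (e'(x := a)) s p" if "\<forall>n<K. e n = e' n" for e e' s a
    using that by (intro K) simp
  then show ?case unfolding sat.simps by blast
next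
  case (ExN x p)
  then obtain K where
    K: "\<And>e e' s. (\<forall>n<K. e n = e' n) \<Longrightarrow> sat S e s p \<longleftrightarrow> sat S e' s p" by blast
  have "sat S (e(x := a)) s p \<longleftrightarrow> sat S (e'(x := a)) s p" if "\<forall>n<K. e n = e' n" for e e' s a
    using that by (intro K) simp
  then show ?case unfolding sat.simps by blast
next
  case (Neg p)
  then show ?case by (rule finite_dependence_mono) simp
next
  case (Conj p q)
  show ?case by (rule finite_dependence_mono[OF finite_dependence_conj[OF Conj.IH]]) simp
next
  case (Disj p q)
  show ?case by (rule finite_dependence_mono[OF finite_dependence_conj[OF Disj.IH]]) simp
next
  case (Impl p q)
  show ?case by (rule finite_dependence_mono[OF finite_dependence_conj[OF Impl.IH]]) simp
next
  case (AllS X p)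
  then show ?case unfolding sat.simps by blast
next
  case (ExS X p)
  then show ?case unfolding sat.simps by blast
qed

text \<open>
  Even variables are reserved for the arguments of a relation and odd variables for its parameters.
  The same function merges two parameter lists into one.
\<close>

definition interleave :: "(nat \<Rightarrow> 'b) \<Rightarrow> (nat \<Rightarrow> 'b) \<Rightarrow> nat \<Rightarrow> 'b" where
  "interleave f g n = (if even n then f (n div 2) else g (n div 2))"

lemma interleave_simps [simp]:
  "interleave f g (2 * n) = f n" "interleave f g (Suc (2 * n)) = g n" 
  by (auto simp: interleave_def)

lemma range_interleave: "range f \<subseteq> S \<Longrightarrow> range g \<subseteq> S \<Longrightarrow> range (interleave f g) \<subseteq> S"
  by (auto simp: interleave_def)

text \<open>
  The two kinds of renamings that respect the division into arguments and parameters: the first moves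
  parameters only, the second arguments only.
\<close>

definition keep_even :: "(nat \<Rightarrow> nat) \<Rightarrow> nat \<Rightarrow> nat" where
  "keep_even f n = (if even n then n else Suc (2 * f (n div 2)))"

definition keep_odd :: "(nat \<Rightarrow> nat) \<Rightarrow> nat \<Rightarrow> nat" where
  "keep_odd f n = (if even n then 2 * f (n div 2) else n)"

lemma inj_keep_even:
  assumes "inj f"
  shows "inj (keep_even f)"
proof (rule injI)
  fix x y assume "keep_even f x = keep_even f y"
  then have "even x \<longleftrightarrow> even y"
    unfolding keep_even_def by (auto split: if_splits) presburger?
  then show "x = y" using \<open>keep_even f x = keep_even f y\<close> assms
    unfolding keep_even_def inj_def by (auto elim!: evenE oddE split: if_splits)
qed

lemma inj_keep_odd:
  assumes "inj f"
  shows "inj (keep_odd f)"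
proof (rule injI)
  fix x y assume "keep_odd f x = keep_odd f y"
  then have "even x \<longleftrightarrow> even y"
    unfolding keep_odd_def by (auto split: if_splits) presburger?
  then show "x = y" using \<open>keep_odd f x = keep_odd f y\<close> assms
    unfolding keep_odd_def inj_def by (auto elim!: evenE oddE split: if_splits)
qed

lemmas inj_keep = inj_keep_even inj_keep_odd

lemma interleave_keep:
  "interleave f g \<circ> keep_even h = interleave f (g \<circ> h)"
  "interleave f g \<circ> keep_odd h = interleave (f \<circ> h) g"
  by (auto simp: fun_eq_iff interleave_def keep_even_def keep_odd_def)

text \<open>
  The number parameters \<open>c\<close> and the set parameters \<open>s\<close> are hidden in the quantifiers: elements of
  the model and members of \<open>S\<close> may occur freely in a definable relation.
\<close>

definition definable_tm :: "((nat \<Rightarrow> 'a::discretely_ordered_semiring) \<Rightarrow> 'a) \<Rightarrow> bool" where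
  "definable_tm f \<longleftrightarrow> (\<exists>t c. \<forall>e. tm_val (interleave e c) t = f e)"

definition definable ::
  "'a::discretely_ordered_semiring set set \<Rightarrow> ((nat \<Rightarrow> 'a) \<Rightarrow> bool) \<Rightarrow> bool" where
  "definable S R \<longleftrightarrow>
    (\<exists>p c s. bounded_fm p \<and> range s \<subseteq> S \<and> (\<forall>e. sat S (interleave e c) s p \<longleftrightarrow> R e))"

definition even_slot :: "nat \<Rightarrow> nat" where "even_slot n = 2 * n"
definition odd_slot :: "nat \<Rightarrow> nat" where "odd_slot n = Suc (2 * n)"

lemma inj_slots: "inj even_slot" "inj odd_slot"
  by (auto simp: inj_def even_slot_def odd_slot_def)

lemma interleave_slots [simp]: "interleave f g \<circ> even_slot = f" "interleave f g \<circ> odd_slot = g"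
  by (auto simp: fun_eq_iff even_slot_def odd_slot_def)

lemma definable_tm_common:
  assumes "definable_tm f" "definable_tm g"
  obtains c t u where "\<And>e. tm_val (interleave e c) t = f e" "\<And>e. tm_val (interleave e c) u = g e"
proof -
  obtain t c u d where "\<And>e. tm_val (interleave e c) t = f e" "\<And>e. tm_val (interleave e d) u = g e"
    using assms unfolding definable_tm_def by blast
  then show thesis
    by (intro that[of "interleave c d" "rename_tm (keep_even even_slot) t" "rename_tm (keep_even odd_slot) u"])
      (simp_all add: tm_val_rename interleave_keep)
qed

text \<open>
  Two formulas may use different parameters. They are moved to disjoint places, so that one
  assignment serves both.
\<close>

lemma definable_common:
  assumes "definable S P" "definable S Q"
  obtains p q s c where "bounded_fm p" "bounded_fm q" "range s \<subseteq> S"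
    "\<And>e. sat S (interleave e c) s p \<longleftrightarrow> P e" "\<And>e. sat S (interleave e c) s q \<longleftrightarrow> Q e"
proof -
  obtain p c s where 1: "bounded_fm p" "range s \<subseteq> S" "\<And>e. sat S (interleave e c) s p \<longleftrightarrow> P e"
    using assms(1) unfolding definable_def by blast
  obtain q d r where 2: "bounded_fm q" "range r \<subseteq> S" "\<And>e. sat S (interleave e d) r q \<longleftrightarrow> Q e"
    using assms(2) unfolding definable_def by blast
  show thesis
    by (rule that[of "rename_fm (keep_even even_slot) even_slot p" "rename_fm (keep_even odd_slot) odd_slot q"
          "interleave s r" "interleave c d"])
      (simp_all add: 1 2 bounded_rename sat_rename interleave_keep inj_keep inj_slots range_interleave)
qed

lemma definable_tm_fm_common:
  assumes "definable_tm f" "definable S Q"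
  obtains q s c t where "bounded_fm q" "range s \<subseteq> S"
    "\<And>e. tm_val (interleave e c) t = f e" "\<And>e. sat S (interleave e c) s q \<longleftrightarrow> Q e"
proof -
  obtain t c where 1: "\<And>e. tm_val (interleave e c) t = f e"
    using assms(1) unfolding definable_tm_def by blast
  obtain q d r where 2: "bounded_fm q" "range r \<subseteq> S" "\<And>e. sat S (interleave e d) r q \<longleftrightarrow> Q e"
    using assms(2) unfolding definable_def by blast
  show thesis
    by (rule that[of "rename_fm (keep_even odd_slot) id q" r "interleave c d" "rename_tm (keep_even even_slot) t"])
      (simp_all add: 1 2 bounded_rename tm_val_rename sat_rename interleave_keep inj_keep inj_slots)
qed

lemma definable_rename:
  assumes "definable S R" "inj \<rho>"
  shows "definable S (\<lambda>e. R (e \<circ> \<rho>))"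
proof -
  obtain p c s where "bounded_fm p" "range s \<subseteq> S" "\<forall>e. sat S (interleave e c) s p \<longleftrightarrow> R e"
    using assms unfolding definable_def by blast
  then show ?thesis unfolding definable_def
    by (intro exI[of _ "rename_fm (keep_odd \<rho>) id p"] exI[of _ c] exI[of _ s])
      (simp add: bounded_rename sat_rename interleave_keep inj_keep assms)
qed

named_theorems definable_intros

lemma definable_tm_Var [definable_intros]: "definable_tm (\<lambda>e. e n)"
  unfolding definable_tm_def by (rule exI[of _ "Var (2 * n)"]) simp

lemma definable_tm_const [definable_intros]: "definable_tm (\<lambda>e. c)"
  unfolding definable_tm_def by (intro exI[of _ "Var 1"] exI[of _ "\<lambda>_. c"]) (simp add: interleave_def)

lemma definable_tm_binop:
  assumes "definable_tm f" "definable_tm g"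
  shows "definable_tm (\<lambda>e. f e + g e)" "definable_tm (\<lambda>e. f e * g e)"
proof -
  obtain t u c where "\<And>e. tm_val (interleave e c) t = f e" "\<And>e. tm_val (interleave e c) u = g e"
    by (rule definable_tm_common[OF assms]) (rule that)
  then have "\<forall>e. tm_val (interleave e c) (Add t u) = f e + g e"
    "\<forall>e. tm_val (interleave e c) (Mult t u) = f e * g e" by simp_all
  then show "definable_tm (\<lambda>e. f e + g e)" "definable_tm (\<lambda>e. f e * g e)"
    unfolding definable_tm_def by blast+
qed

lemmas [definable_intros] = definable_tm_binop

lemma definable_tm_cpair [definable_intros]:
  "definable_tm f \<Longrightarrow> definable_tm g \<Longrightarrow> definable_tm (\<lambda>e. cpair (f e) (g e))"
  unfolding cpair_def power2_eq_square by (intro definable_intros)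

locale rca0_model =
  fixes S :: "'a::discretely_ordered_semiring set set"
  assumes rca0: "RCA0 S"
begin

lemma ex_sets: "\<exists>s :: nat \<Rightarrow> 'a set. range s \<subseteq> S"
proof -
  have "S \<noteq> {}" using rca0 unfolding RCA0_def by simp
  then obtain A where "A \<in> S" by fast
  then have "range (\<lambda>_::nat. A) \<subseteq> S" by auto
  then show ?thesis by (rule exI[of _ "\<lambda>_. A"])
qed

lemma definable_Eq_Less:
  assumes "definable_tm f" "definable_tm g"
  shows "definable S (\<lambda>e. f e = g e)" "definable S (\<lambda>e. f e < g e)"
proof -
  obtain t u c where tu: "\<And>e. tm_val (interleave e c) t = f e" "\<And>e. tm_val (interleave e c) u = g e"
    by (rule definable_tm_common[OF assms]) (rule that)
  obtain s :: "nat \<Rightarrow> 'a set" where s: "range s \<subseteq> S" using ex_sets by blast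
  show "definable S (\<lambda>e. f e = g e)" unfolding definable_def
    by (intro exI[of _ "Eq t u"] exI[of _ c] exI[of _ s]) (simp add: tu s bounded_fm.intros)
  show "definable S (\<lambda>e. f e < g e)" unfolding definable_def
    by (intro exI[of _ "Less t u"] exI[of _ c] exI[of _ s]) (simp add: tu s bounded_fm.intros)
qed

lemmas [definable_intros] = definable_Eq_Less

lemma definable_Mem [definable_intros]:
  assumes "definable_tm f" "A \<in> S"
  shows "definable S (\<lambda>e. f e \<in> A)"
proof -
  obtain t c where "\<forall>e. tm_val (interleave e c) t = f e"
    using assms unfolding definable_tm_def by blast
  then show ?thesis unfolding definable_def
    by (intro exI[of _ "Mem t 0"] exI[of _ c] exI[of _ "\<lambda>_. A"])
      (simp add: bounded_fm.intros assms)
qed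

lemma definable_Neg [definable_intros]:
  assumes "definable S P"
  shows "definable S (\<lambda>e. \<not> P e)"
proof -
  obtain p c s where "bounded_fm p" "range s \<subseteq> S" "\<forall>e. sat S (interleave e c) s p \<longleftrightarrow> P e"
    using assms unfolding definable_def by blast
  then show ?thesis unfolding definable_def
    by (intro exI[of _ "Neg p"] exI[of _ c] exI[of _ s]) (simp add: bounded_fm.intros)
qed

lemma definable_Conj [definable_intros]:
  assumes "definable S P" "definable S Q"
  shows "definable S (\<lambda>e. P e \<and> Q e)"
proof -
  obtain p q c s where "bounded_fm p" "bounded_fm q" "range s \<subseteq> S"
    "\<And>e. sat S (interleave e c) s p \<longleftrightarrow> P e" "\<And>e. sat S (interleave e c) s q \<longleftrightarrow> Q e"
    by (rule definable_common[OF assms]) (rule that)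
  then show ?thesis unfolding definable_def
    by (intro exI[of _ "Conj p q"] exI[of _ c] exI[of _ s]) (simp add: bounded_fm.intros)
qed

lemma definable_Disj [definable_intros]:
  assumes "definable S P" "definable S Q"
  shows "definable S (\<lambda>e. P e \<or> Q e)"
proof -
  have "definable S (\<lambda>e. \<not> (\<not> P e \<and> \<not> Q e))"
    by (intro definable_Neg definable_Conj assms)
  then show ?thesis by simp
qed

lemma definable_Impl [definable_intros]:
  assumes "definable S P" "definable S Q"
  shows "definable S (\<lambda>e. P e \<longrightarrow> Q e)"
proof -
  have "definable S (\<lambda>e. \<not> P e \<or> Q e)"
    by (intro definable_Neg definable_Disj assms)
  then show ?thesis by simp
qed

lemma definable_le [definable_intros]:
  "definable_tm f \<Longrightarrow> definable_tm g \<Longrightarrow> definable S (\<lambda>e. f e \<le> g e)"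
  using definable_Neg[OF definable_Eq_Less(2), of g f] by (simp add: not_less)

text \<open>
  In the second premise the bound variable has index 0 and all other indices are increased by 1. The
  formula for that premise is converted to named variables: its variable 0 is renamed to a variable
  \<open>x\<close> beyond all variables that occur, and the other argument variables move back by one place.
\<close>

lemma definable_bounded_Ex [definable_intros]:
  assumes "definable_tm f" "definable S (\<lambda>e. R (\<lambda>n. e (Suc n)) (e 0))"
  shows "definable S (\<lambda>e. \<exists>a. a < f e \<and> R e a)"
proof -
  obtain t p c s where bp: "bounded_fm p" and s: "range s \<subseteq> S"
    and t: "\<And>e. tm_val (interleave e c) t = f e"
    and p: "\<And>e. sat S (interleave e c) s p \<longleftrightarrow> R (\<lambda>n. e (Suc n)) (e 0)"
    by (rule definable_tm_fm_common[OF assms]) (rule that)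
  from sat_finite_dependence[of S p] obtain K where
    K: "\<forall>e e'. (\<forall>n<K. e n = e' n) \<longrightarrow> (\<forall>s. sat S e s p \<longleftrightarrow> sat S e' s p)" ..
  obtain L where L: "\<forall>n\<in>tm_vars t. n < L" using tm_vars_bounded by blast
  \<comment> \<open>The variables are even because odd variables hold parameters.\<close>
  define x where "x = 2 * (K + L)"
  define \<rho> where "\<rho> n = (if n = 0 then x else if even n \<and> n \<le> x then n - 2 else n)" for n
  have "inj \<rho>"
    unfolding inj_def \<rho>_def x_def by (auto split: if_splits elim!: evenE)
  have fresh: "x \<notin> tm_vars t" using L unfolding x_def by fastforce
  let ?q = "rename_fm \<rho> id p"
  have q: "sat S ((interleave e c)(x := a)) s ?q \<longleftrightarrow> R e a" for e a
  proof -
    have agree: "((interleave e c)(x := a) \<circ> \<rho>) n = interleave (case_nat a e) c n" if "n < K" for n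
    proof (cases "even n")
      case True
      then obtain m where m: "n = 2 * m" by blast
      show ?thesis
      proof (cases m)
        case 0
        then show ?thesis by (simp add: m \<rho>_def interleave_def)
      next
        case (Suc k)
        then have "\<rho> n = 2 * k" "2 * k \<noteq> x" using m that by (auto simp: \<rho>_def x_def)
        moreover have "interleave (case_nat a e) c n = e k"
          unfolding m Suc interleave_simps by simp
        ultimately show ?thesis by simp
      qed
    next
      case False
      then obtain m where m: "n = Suc (2 * m)" by (metis oddE Suc_eq_plus1)
      then have "\<rho> n = n" "n \<noteq> x" using that by (auto simp: \<rho>_def x_def) presburger?
      then show ?thesis by (simp add: m)
    qed
    then have "sat S ((interleave e c)(x := a) \<circ> \<rho>) s p \<longleftrightarrow> sat S (interleave (case_nat a e) c) s p"
      using K[rule_format, of "(interleave e c)(x := a) \<circ> \<rho>" "interleave (case_nat a e) c" s] agree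
      by blast
    then show ?thesis using p \<open>inj \<rho>\<close> by (simp add: sat_rename)
  qed
  have "tm_val ((interleave e c)(x := a)) t = f e" for e a
    using t tm_val_cong[of t "(interleave e c)(x := a)" "interleave e c"] fresh by fastforce
  then have "sat S (interleave e c) s (ExN x (Conj (Less (Var x) t) ?q)) \<longleftrightarrow> (\<exists>a. a < f e \<and> R e a)" for e
    using q by simp
  moreover have "bounded_fm (ExN x (Conj (Less (Var x) t) ?q))"
    by (intro bounded_fm.intros fresh bounded_rename bp \<open>inj \<rho>\<close>)
  ultimately show ?thesis
    unfolding definable_def using s by blast
qed

lemma definable_bounded_Ex_le [definable_intros]:
  assumes "definable_tm f" "definable S (\<lambda>e. R (\<lambda>n. e (Suc n)) (e 0))"
  shows "definable S (\<lambda>e. \<exists>a. a \<le> f e \<and> R e a)"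
  unfolding less_eq_iff_succ_less by (intro definable_intros assms)

lemma definable_bounded_All [definable_intros]:
  assumes "definable_tm f" "definable S (\<lambda>e. R (\<lambda>n. e (Suc n)) (e 0))"
  shows "definable S (\<lambda>e. \<forall>a. a < f e \<longrightarrow> R e a)"
    and "definable S (\<lambda>e. \<forall>a. a \<le> f e \<longrightarrow> R e a)"
proof -
  have "definable S (\<lambda>e. \<not> (\<exists>a. a < f e \<and> \<not> R e a))"
    by (intro definable_intros assms)
  then show "definable S (\<lambda>e. \<forall>a. a < f e \<longrightarrow> R e a)" by simp
  have "definable S (\<lambda>e. \<not> (\<exists>a. a \<le> f e \<and> \<not> R e a))"
    by (intro definable_intros assms)
  then show "definable S (\<lambda>e. \<forall>a. a \<le> f e \<longrightarrow> R e a)" by simp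
qed

section \<open>Comprehension and induction\<close>

text \<open>
  Arguments 0 and 1 of a relation are the variables 0 and 2 of its formula.
\<close>

lemma interleave_upd:
  "(interleave e c)(0 := n) = interleave (e(0 := n)) c"
  "(interleave e c)(2 := n) = interleave (e(1 := n)) c"
  by (auto simp: fun_eq_iff interleave_def)

lemma Delta01_comprehension_rule:
  assumes "definable S (\<lambda>e. A (e 0) (e 1))" "definable S (\<lambda>e. B (e 0) (e 1))"
    and eq: "\<And>n. (\<exists>x. A n x) \<longleftrightarrow> (\<forall>x. B n x)"
  shows "{n. \<exists>x. A n x} \<in> S"
proof -
  obtain p q c s where *: "bounded_fm p" "bounded_fm q" "range s \<subseteq> S"
    "\<And>e. sat S (interleave e c) s p \<longleftrightarrow> A (e 0) (e 1)"
    "\<And>e. sat S (interleave e c) s q \<longleftrightarrow> B (e 0) (e 1)"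
    by (rule definable_common[OF assms(1,2)]) (rule that)
  let ?e = "interleave (\<lambda>_. 0) c"
  have A: "sat S (?e(0 := n)) s (ExN 2 p) \<longleftrightarrow> (\<exists>x. A n x)" for n
    using * by (simp add: interleave_upd)
  have B: "sat S (?e(0 := n)) s (AllN 2 q) \<longleftrightarrow> (\<forall>x. B n x)" for n
    using * by (simp add: interleave_upd)
  have "Sigma01_fm (ExN 2 p)" "Pi01_fm (AllN 2 q)"
    using * unfolding Sigma01_fm_def Pi01_fm_def by blast+
  moreover have "\<forall>n. sat S (?e(0 := n)) s (ExN 2 p) \<longleftrightarrow> sat S (?e(0 := n)) s (AllN 2 q)"
    unfolding A B using eq by blast
  moreover have "Delta01_comprehension S" using rca0 unfolding RCA0_def by blast
  ultimately have "{n. sat S (?e(0 := n)) s (ExN 2 p)} \<in> S"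
    unfolding Delta01_comprehension_def using \<open>range s \<subseteq> S\<close> by blast
  then show ?thesis unfolding A .
qed

lemma bounded_comprehension: "definable S (\<lambda>e. R (e 0)) \<Longrightarrow> {n. R n} \<in> S"
  using Delta01_comprehension_rule[of "\<lambda>n x. R n" "\<lambda>n x. R n"] by simp

lemma Sigma01_induction_rule [consumes 1, case_names 0 Suc]:
  assumes "definable S (\<lambda>e. R (e 0) (e 1))"
    and "\<exists>x. R 0 x" and "\<And>n. \<exists>x. R n x \<Longrightarrow> \<exists>x. R (n + 1) x"
  shows "\<exists>x. R n x"
proof -
  obtain p c s where *:
    "bounded_fm p" "range s \<subseteq> S" "\<forall>e. sat S (interleave e c) s p \<longleftrightarrow> R (e 0) (e 1)"
    using assms(1) unfolding definable_def by blast
  let ?e = "interleave (\<lambda>_. 0) c"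
  have R: "sat S (?e(0 := n)) s (ExN 2 p) \<longleftrightarrow> (\<exists>x. R n x)" for n
    using * by (simp add: interleave_upd)
  have "Sigma01_induction S" using rca0 unfolding RCA0_def by blast
  moreover have "Sigma01_fm (ExN 2 p)" using * unfolding Sigma01_fm_def by blast
  moreover have "sat S (?e(0 := 0)) s (ExN 2 p)" unfolding R by fact
  moreover have "\<forall>n. sat S (?e(0 := n)) s (ExN 2 p) \<longrightarrow> sat S (?e(0 := n + 1)) s (ExN 2 p)"
    unfolding R using assms(3) by blast
  ultimately have "\<forall>n. sat S (?e(0 := n)) s (ExN 2 p)"
    using \<open>range s \<subseteq> S\<close> unfolding Sigma01_induction_def by blast
  then show ?thesis unfolding R by blast
qed

lemma bounded_induction [consumes 1, case_names 0 Suc]: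
  assumes "definable S (\<lambda>e. R (e 0))" and "R 0" and "\<And>n. R n \<Longrightarrow> R (n + 1)"
  shows "R n"
  using Sigma01_induction_rule[of "\<lambda>n x. R n"] assms by simp

lemma ex_least:
  assumes "definable S (\<lambda>e. R (e 0))" and "R a"
  shows "\<exists>n. R n \<and> (\<forall>m<n. \<not> R m)"
proof (rule ccontr)
  assume no: "\<not> ?thesis"
  have def: "definable S (\<lambda>e. \<forall>m<e 0. \<not> R m)"
    by (intro definable_intros assms(1))
  have "\<forall>m<n. \<not> R m" for n
    using def
  proof (induction n rule: bounded_induction)
    case (Suc n)
    then show ?case using no unfolding less_eq_iff_succ_less[symmetric] le_less by blast
  qed simp
  then show False using \<open>R a\<close> less_add_one by blast
qed

end

section \<open>Pairs and embeddings\<close>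

lemma le_square: "(x :: 'a::discretely_ordered_semiring) \<le> x * x"
proof (cases "x = 0")
  case False
  then have "0 < x" by (simp add: zero_less_iff_neq_zero)
  then have "1 \<le> x" using less_iff_succ_less_eq[of 0 x] by simp
  then show ?thesis using mult_left_mono[of 1 x x] by simp
qed simp

lemma cpair_ge: "(x :: 'a::discretely_ordered_semiring) \<le> cpair x y" "x \<le> cpair y x"
proof -
  show "x \<le> cpair x y" by (simp add: cpair_def)
  have "x \<le> y + x" by simp
  also have "\<dots> \<le> (y + x) * (y + x)" by (rule le_square)
  also have "\<dots> \<le> cpair y x" by (simp add: cpair_def power2_eq_square)
  finally show "x \<le> cpair y x" .
qed

text \<open>
  The code of a pair with sum \<open>s\<close> lies between \<open>s\<^sup>2\<close> and \<open>s\<^sup>2 + s\<close>, hence below \<open>(s + 1)\<^sup>2\<close>.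
\<close>

lemma cpair_less_cpair:
  fixes x y :: "'a::discretely_ordered_semiring"
  assumes "x + y < x' + y'"
  shows "cpair x y < cpair x' y'"
proof -
  let ?s = "x + y" and ?t = "x' + y'"
  have "cpair x y \<le> ?s * ?s + ?s"
    unfolding cpair_def power2_eq_square by (intro add_left_mono) simp
  also have "\<dots> < ?s * ?s + ?s + ?s + 1"
    unfolding less_eq_iff_succ_less[symmetric] by simp
  also have "\<dots> = (?s + 1) * (?s + 1)" by (simp add: algebra_simps)
  also have "\<dots> \<le> ?t * ?t"
    using assms unfolding less_iff_succ_less_eq by (intro mult_mono) auto
  also have "\<dots> \<le> cpair x' y'" by (simp add: cpair_def power2_eq_square)
  finally show ?thesis .
qed

lemma cpair_inject [simp]:
  fixes x y :: "'a::discretely_ordered_semiring"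
  shows "cpair x y = cpair x' y' \<longleftrightarrow> x = x' \<and> y = y'"
proof
  assume eq: "cpair x y = cpair x' y'"
  then have s: "x + y = x' + y'"
    using cpair_less_cpair[of x y x' y'] cpair_less_cpair[of x' y' x y]
    by (cases "x + y" "x' + y'" rule: linorder_cases) auto
  then have "x = x'" using eq by (simp add: cpair_def)
  then show "x = x' \<and> y = y'" using s by simp
qed simp

definition pairs_of :: "('a::discretely_ordered_semiring \<Rightarrow> 'a \<Rightarrow> bool) \<Rightarrow> 'a set" where
  "pairs_of R = {cpair x y | x y. R x y}"

lemma cpair_in_pairs_of [simp]: "cpair x y \<in> pairs_of R \<longleftrightarrow> R x y"
  by (auto simp: pairs_of_def)

lemma rel_of_pairs_of [simp]: "rel_of (pairs_of R) = {(x, y). R x y}"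
  by (simp add: rel_of_def)

context rca0_model
begin

lemma pairs_comprehension:
  assumes "definable S (\<lambda>e. R (e 0) (e 1))"
  shows "pairs_of R \<in> S"
proof -
  have "{n. \<exists>y\<le>n. \<exists>x\<le>n. n = cpair x y \<and> R x y} \<in> S"
    using assms by (intro bounded_comprehension definable_intros) simp
  also have "{n. \<exists>y\<le>n. \<exists>x\<le>n. n = cpair x y \<and> R x y} = pairs_of R"
    unfolding pairs_of_def using cpair_ge by blast
  finally show ?thesis .
qed

text \<open>
  The relation is replaced by the set of codes of its pairs, so that the substituted formula is
  atomic.
\<close>

lemma definable_subst:
  assumes "definable S (\<lambda>e. R (e 0) (e 1))" "definable_tm f" "definable_tm g"
  shows "definable S (\<lambda>e. R (f e) (g e))"
  using definable_Mem[OF definable_tm_cpair[OF assms(2,3)] pairs_comprehension[OF assms(1)]] by simp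

lemma definable_rel_of [definable_intros]:
  assumes "definable_tm f" "definable_tm g" "L \<in> S"
  shows "definable S (\<lambda>e. (f e, g e) \<in> rel_of L)"
  using definable_Mem[OF definable_tm_cpair[OF assms(1,2)] assms(3)] by (simp add: rel_of_def)

text \<open>
  Embeddings are handled as functions of the logic whose graph on \<open>P\<close> is definable; this lemma and
  the next translate from and to coded graphs.
\<close>

lemma embeds_intoI:
  assumes "definable S (\<lambda>e. e 0 \<in> P \<and> f (e 0) = e 1)" and "inj_on f P"
    and "\<And>x. x \<in> P \<Longrightarrow> f x \<in> fst U"
    and "\<And>x y. (x, y) \<in> r \<Longrightarrow> x \<in> P \<Longrightarrow> y \<in> P \<Longrightarrow> (f x, f y) \<in> snd U"
  shows "embeds_into S (P, r) U"
  unfolding embeds_into_def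
proof (rule bexI)
  show "pairs_of (\<lambda>x y. x \<in> P \<and> f x = y) \<in> S" by (rule pairs_comprehension) (rule assms(1))
qed (use assms(2-) in \<open>auto simp: single_valued_def inj_on_def\<close>)

lemma embeds_intoE:
  assumes "embeds_into S (P, r) U"
  obtains f where "definable S (\<lambda>e. e 0 \<in> P \<and> f (e 0) = e 1)" "inj_on f P"
    "\<And>x. x \<in> P \<Longrightarrow> f x \<in> fst U"
    "\<And>x y. (x, y) \<in> r \<Longrightarrow> x \<in> P \<Longrightarrow> y \<in> P \<Longrightarrow> (f x, f y) \<in> snd U"
proof -
  obtain h where h: "h \<in> S" "single_valued (rel_of h)" "Domain (rel_of h) = P"
    "Range (rel_of h) \<subseteq> fst U" "single_valued ((rel_of h)\<inverse>)"
    and mono: "\<And>x y u v. (x, y) \<in> r \<Longrightarrow> (x, u) \<in> rel_of h \<Longrightarrow> (y, v) \<in> rel_of h \<Longrightarrow> (u, v) \<in> snd U"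
    using assms unfolding embeds_into_def by auto
  define f where "f x = (THE y. (x, y) \<in> rel_of h)" for x
  have graph: "x \<in> P \<and> f x = y \<longleftrightarrow> (x, y) \<in> rel_of h" for x y
  proof -
    have "f x = y" if "(x, y) \<in> rel_of h" for y
      unfolding f_def using that h(2) by (auto simp: single_valued_def)
    then show ?thesis using h(3) by blast
  qed
  then have graph': "(x, f x) \<in> rel_of h" if "x \<in> P" for x using that by blast
  show thesis
  proof (rule that)
    show "definable S (\<lambda>e. e 0 \<in> P \<and> f (e 0) = e 1)"
      unfolding graph by (intro definable_intros h(1))
    show "inj_on f P"
      using graph' h(5) unfolding inj_on_def single_valued_def by (metis converse_iff)
    show "f x \<in> fst U" if "x \<in> P" for x using graph'[OF that] h(4) by blast
    show "(f x, f y) \<in> snd U" if "(x, y) \<in> r" "x \<in> P" "y \<in> P" for x y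
      using mono graph' that by blast
  qed
qed

text \<open>
  The graph of an embedding of the converse order is an embedding of the order into the converse.
\<close>

lemma embeddable_dual:
  assumes "embeddable S like (U, u)"
    and "\<And>P r. like' (P, r) \<Longrightarrow> like (P, r\<inverse>)"
  shows "embeddable S like' (U, u\<inverse>)"
  unfolding embeddable_def
proof (intro ballI impI, elim conjE)
  fix P L assume PL: "P \<in> S" "L \<in> S" "partial_order_on P (rel_of L)" "like' (P, rel_of L)"
  define L' where "L' = pairs_of (\<lambda>x y. (y, x) \<in> rel_of L)"
  have "L' \<in> S" unfolding L'_def using PL by (intro pairs_comprehension definable_intros)
  have L': "rel_of L' = (rel_of L)\<inverse>" by (auto simp: L'_def)
  then have "embeds_into S (P, (rel_of L)\<inverse>) (U, u)"
    using assms PL \<open>L' \<in> S\<close> unfolding embeddable_def by (metis partial_order_on_converse)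
  then obtain f where f: "definable S (\<lambda>e. e 0 \<in> P \<and> f (e 0) = e 1)" "inj_on f P"
    "\<And>x. x \<in> P \<Longrightarrow> f x \<in> fst (U, u)"
    "\<And>x y. (x, y) \<in> (rel_of L)\<inverse> \<Longrightarrow> x \<in> P \<Longrightarrow> y \<in> P \<Longrightarrow> (f x, f y) \<in> snd (U, u)"
    by (rule embeds_intoE) (rule that)
  then show "embeds_into S (P, rel_of L) (U, u\<inverse>)"
    by (intro embeds_intoI[of P f]) auto
qed

lemma omega_embeddable_iff_omega_star_embeddable:
  "omega_embeddable S \<longleftrightarrow> omega_star_embeddable S"
proof -
  have *: "omega_star = (UNIV, {(x, y). x \<le> y}\<inverse>)" "omega = (UNIV, {(x, y). y \<le> x}\<inverse>)"
    by (auto simp: omega_star_def omega_def)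
  have **: "omega_star_like (P, r) \<longleftrightarrow> omega_like (P, r\<inverse>)" for P r
    by (simp add: omega_like_def omega_star_like_def predecessors_def successors_def po_less_def conj_ac eq_commute)
  show ?thesis
  proof
    assume "omega_embeddable S"
    then show "omega_star_embeddable S" unfolding omega_embeddable_def omega_star_embeddable_def *(1)
      by (intro embeddable_dual[of omega_like]) (simp_all add: omega_def **)
  next
    assume "omega_star_embeddable S"
    then show "omega_embeddable S" unfolding omega_embeddable_def omega_star_embeddable_def *(2)
      by (intro embeddable_dual[of omega_star_like]) (simp_all add: omega_star_def **)
  qed
qed

section \<open>Reductions to the order type of the natural numbers\<close>

lemma zeta_cases:
  assumes "w \<in> fst zeta"
  obtains j where "w = cpair 0 j" | j where "w = cpair 1 j"
  using assms by (auto simp: zeta_def po_sum_def omega_def omega_star_def)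

lemma zeta_simps [simp]:
  "(cpair 0 x, cpair 0 y) \<in> snd zeta \<longleftrightarrow> y \<le> x"
  "(cpair 0 x, cpair 1 y) \<in> snd zeta"
  "(cpair 1 x, cpair 0 y) \<notin> snd zeta"
  "(cpair 1 x, cpair 1 y) \<in> snd zeta \<longleftrightarrow> x \<le> y"
  by (auto simp: zeta_def po_sum_def omega_def omega_star_def)

lemma omega_plus_omega_star_cases:
  assumes "w \<in> fst omega_plus_omega_star"
  obtains j where "w = cpair 0 j" | j where "w = cpair 1 j"
  using assms by (auto simp: omega_plus_omega_star_def po_sum_def omega_def omega_star_def)

lemma omega_plus_omega_star_simps [simp]:
  "(cpair 0 x, cpair 0 y) \<in> snd omega_plus_omega_star \<longleftrightarrow> x \<le> y"
  "(cpair 0 x, cpair 1 y) \<in> snd omega_plus_omega_star"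
  "(cpair 1 x, cpair 0 y) \<notin> snd omega_plus_omega_star"
  "(cpair 1 x, cpair 1 y) \<in> snd omega_plus_omega_star \<longleftrightarrow> y \<le> x"
  by (auto simp: omega_plus_omega_star_def po_sum_def omega_def omega_star_def)

text \<open>
  Element \<open>x\<close> of \<open>P\<close> becomes \<open>x + 1\<close>, and 0 is a new least element. Its image \<open>(0, k)\<close> bounds the
  part \<open>\<omega>\<^sup>*\<close> of the range, so the final segment of \<open>\<zeta>\<close> above it is a copy of \<open>\<omega>\<close>.
\<close>

lemma omega_embeddable_if_zeta_embeddable:
  assumes "zeta_embeddable S"
  shows "omega_embeddable S"
  unfolding omega_embeddable_def embeddable_def
proof (intro ballI impI, elim conjE)
  fix P L assume PL: "P \<in> S" "L \<in> S" and po: "partial_order_on P (rel_of L)"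
    and like: "omega_like (P, rel_of L)"
  define r where "r = rel_of L"
  have r: "r \<subseteq> P \<times> P" "\<And>x. x \<in> P \<Longrightarrow> (x, x) \<in> r" "antisym r" "trans r"
    using po unfolding r_def partial_order_on_def preorder_on_def refl_on_def by auto
  define P' where "P' = {n. n = 0 \<or> (\<exists>x\<le>n. n = x + 1 \<and> x \<in> P)}"
  define R' where "R' x y \<longleftrightarrow> y \<in> P' \<and> (x = 0 \<or> (\<exists>a\<le>x. \<exists>b\<le>y. x = a + 1 \<and> y = b + 1 \<and> (a, b) \<in> r))" for x y
  have "P' \<in> S" unfolding P'_def using PL by (intro bounded_comprehension definable_intros)
  have "pairs_of R' \<in> S" unfolding R'_def r_def using PL \<open>P' \<in> S\<close>
    by (intro pairs_comprehension definable_intros)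
  have P'[simp]: "0 \<in> P'" "x + 1 \<in> P' \<longleftrightarrow> x \<in> P" for x by (auto simp: P'_def)
  have P'_cases: "x = 0 \<or> (\<exists>a\<in>P. x = a + 1)" if "x \<in> P'" for x using that by (auto simp: P'_def)
  have R'[simp]: "R' 0 0" "R' 0 (b + 1) \<longleftrightarrow> b \<in> P" "\<not> R' (a + 1) 0" "R' (a + 1) (b + 1) \<longleftrightarrow> (a, b) \<in> r" for a b
    using r(1) by (auto simp: R'_def)
  have R'_field: "x \<in> P' \<and> y \<in> P'" if "R' x y" for x y
    using that r(1) unfolding R'_def by auto
  have po': "partial_order_on P' {(x, y). R' x y}"
    unfolding partial_order_on_def preorder_on_def
  proof (intro conjI)
    show "{(x, y). R' x y} \<subseteq> P' \<times> P'" using R'_field by auto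
    show "refl_on P' {(x, y). R' x y}"
      using P'_cases r(2) by (fastforce simp: refl_on_def)
    show "trans {(x, y). R' x y}"
    proof (rule transI, clarify)
      fix x y z assume *: "R' x y" "R' y z"
      then have "x \<in> P'" "y \<in> P'" "z \<in> P'" using R'_field by blast+
      then show "R' x z" using * P'_cases[of x] P'_cases[of y] P'_cases[of z] r(4) 
        by (auto elim: transE)
    qed
    show "antisym {(x, y). R' x y}"
    proof (rule antisymI, clarify)
      fix x y assume *: "R' x y" "R' y x"
      then have "x \<in> P'" "y \<in> P'" using R'_field by blast+
      then show "x = y" using * P'_cases[of x] P'_cases[of y] antisymD[OF r(3)] by auto
    qed
  qed
  have "zeta_like (P', {(x, y). R' x y})"
    unfolding zeta_like_def
  proof (intro ballI)
    fix x y assume "x \<in> fst (P', {(x, y). R' x y})" "y \<in> fst (P', {(x, y). R' x y})"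
    then have "y \<in> P'" by simp
    then consider "y = 0" | b where "y = b + 1" "b \<in> P" using P'_cases by blast
    then show "fin {z. po_less (P', {(x, y). R' x y}) x z \<and> po_less (P', {(x, y). R' x y}) z y}"
    proof cases
      case 1
      then have "\<not> po_less (P', {(x, y). R' x y}) z y" for z
        using P'_cases[of z] by (auto simp: po_less_def)
      then show ?thesis by (simp add: fin_def)
    next
      case 2
      then obtain m where m: "\<And>c. (c, b) \<in> r \<Longrightarrow> c \<noteq> b \<Longrightarrow> c < m"
        using like r(1) unfolding omega_like_def fin_def predecessors_def po_less_def r_def by fastforce
      have "z < m + 1" if "po_less (P', {(x, y). R' x y}) z y" for z
        using that m 2 P'_cases[of z] unfolding po_less_def
        by (auto simp flip: less_eq_iff_succ_less less_iff_succ_less_eq)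
      then show ?thesis unfolding fin_def by blast
    qed
  qed
  then have "embeds_into S (P', {(x, y). R' x y}) zeta"
    using assms[unfolded zeta_embeddable_def embeddable_def, rule_format, of P' "pairs_of R'"]
      po' \<open>P' \<in> S\<close> \<open>pairs_of R' \<in> S\<close> by simp
  then obtain f where def: "definable S (\<lambda>e. e 0 \<in> P' \<and> f (e 0) = e 1)" and inj: "inj_on f P'"
    and range: "\<And>x. x \<in> P' \<Longrightarrow> f x \<in> fst zeta"
    and mono: "\<And>x y. (x, y) \<in> {(x, y). R' x y} \<Longrightarrow> x \<in> P' \<Longrightarrow> y \<in> P' \<Longrightarrow> (f x, f y) \<in> snd zeta"
    by (rule embeds_intoE) (rule that)
  \<comment> \<open>If the image of 0 lies in the part \<open>\<omega>\<close>, then the part \<open>\<omega>\<^sup>*\<close> is avoided and any \<open>k\<close> will do.\<close>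
  obtain k where k: "f 0 = cpair 0 k \<or> (f 0 = cpair 1 k)"
    using range[of 0] by (auto elim: zeta_cases)
  \<comment> \<open>The isomorphism of \<open>\<omega>\<close> with the final segment of \<open>\<zeta>\<close> that starts at \<open>(0, k)\<close>.\<close>
  define unshift where "unshift v = (if v \<le> k then cpair 0 (k - v) else cpair 1 (v - (k + 1)))" for v :: 'a
  have unshift_eq: "unshift v = w \<longleftrightarrow>
    (\<exists>j\<le>k. v + j = k \<and> w = cpair 0 j) \<or> (\<exists>j\<le>v. v = k + 1 + j \<and> w = cpair 1 j)" for v w
  proof (cases "v \<le> k")
    case True
    then obtain j where "k = v + j" by (auto simp: le_iff_add)
    moreover have "v \<noteq> k + 1 + j" for j
    proof
      assume "v = k + 1 + j"
      then have "k + 1 \<le> v" by simp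
      then show False using True less_iff_succ_less_eq[of k v] by simp
    qed
    ultimately show ?thesis by (auto simp: unshift_def)
  next
    case False
    then have "k + 1 \<le> v" using less_iff_succ_less_eq[of k v] by (simp add: not_le)
    then obtain j where "v = k + 1 + j" by (auto simp: le_iff_add)
    moreover have "v + j \<noteq> k" for j using False by auto
    ultimately show ?thesis using False by (auto simp: unshift_def)
  qed
  have unshift_mono: "u \<le> v" if "(unshift u, unshift v) \<in> snd zeta" for u v
    using that by (auto simp: unshift_def split: if_splits)
       (metis le_add_diff_inverse2 add_le_cancel_left add_le_cancel_right add.commute linear not_le less_iff_succ_less_eq)+
  have unshift_inj: "u = v" if "unshift u = unshift v" for u v
  proof (rule antisym)
    have "(unshift v, unshift v) \<in> snd zeta" by (simp add: unshift_def)
    then show "u \<le> v" "v \<le> u" using that by (auto intro: unshift_mono)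
  qed
  have "\<exists>v. unshift v = f (x + 1)" if "x \<in> P" for x
  proof (cases rule: zeta_cases[OF range[of "x + 1"]])
    case 1 then show ?case using that by simp
  next
    case (2 j)
    have "(f 0, f (x + 1)) \<in> snd zeta" using that by (intro mono) auto
    then have "j \<le> k" using k 2 by auto
    then show ?thesis using 2 unshift_eq by (metis add.commute le_iff_add)
  next
    case (3 j)
    then show ?thesis by (intro exI[of _ "k + 1 + j"]) (simp add: unshift_eq)
  qed
  then obtain g where g: "\<And>x. x \<in> P \<Longrightarrow> unshift (g x) = f (x + 1)" by metis
  define h where "h = pairs_of (\<lambda>x y. x \<in> P' \<and> f x = y)"
  have "h \<in> S" unfolding h_def using def by (intro pairs_comprehension)
  have g_eq: "x \<in> P \<and> g x = v \<longleftrightarrow> x \<in> P \<and>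
      ((\<exists>j\<le>k. v + j = k \<and> (x + 1, cpair 0 j) \<in> rel_of h) \<or>
       (\<exists>j\<le>v. v = k + 1 + j \<and> (x + 1, cpair 1 j) \<in> rel_of h))" for x v
  proof -
    have "x \<in> P \<and> g x = v \<longleftrightarrow> x \<in> P \<and> unshift v = f (x + 1)"
      using g[of x] unshift_inj[of "g x" v] by auto
    then show ?thesis unfolding unshift_eq h_def by auto
  qed
  show "embeds_into S (P, rel_of L) omega"
  proof (rule embeds_intoI)
    show "definable S (\<lambda>e. e 0 \<in> P \<and> g (e 0) = e 1)"
      unfolding g_eq by (intro definable_intros PL \<open>h \<in> S\<close>)
    show "inj_on g P"
    proof (rule inj_onI)
      fix x y assume "x \<in> P" "y \<in> P" "g x = g y"
      then have "f (x + 1) = f (y + 1)" using g by metis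
      then show "x = y" using inj_onD[OF inj] \<open>x \<in> P\<close> \<open>y \<in> P\<close> by fastforce
    qed
    show "g x \<in> fst omega" for x by (simp add: omega_def)
    show "(g x, g y) \<in> snd omega" if "(x, y) \<in> rel_of L" "x \<in> P" "y \<in> P" for x y
    proof -
      have "(f (x + 1), f (y + 1)) \<in> snd zeta" using that by (intro mono) (auto simp: r_def)
      then show ?thesis using unshift_mono g that by (auto simp: omega_def)
    qed
  qed
qed

text \<open>
  In the product of \<open>P\<close> with \<open>\<omega>\<close> each element lies below an infinite ascending chain, while
  an element of the part \<open>\<omega>\<^sup>*\<close> has finitely many successors. So the copy \<open>(x, 0)\<close> of \<open>P\<close> is sent to
  the part \<open>\<omega>\<close>.
\<close>

lemma omega_embeddable_if_omega_plus_omega_star_embeddable: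
  assumes "omega_plus_omega_star_embeddable S"
  shows "omega_embeddable S"
  unfolding omega_embeddable_def embeddable_def
proof (intro ballI impI, elim conjE)
  fix P L assume PL: "P \<in> S" "L \<in> S" and po: "partial_order_on P (rel_of L)"
    and like: "omega_like (P, rel_of L)"
  define r where "r = rel_of L"
  have r: "r \<subseteq> P \<times> P" "\<And>x. x \<in> P \<Longrightarrow> (x, x) \<in> r" "antisym r" "trans r"
    using po unfolding r_def partial_order_on_def preorder_on_def refl_on_def by auto
  define P' where "P' = pairs_of (\<lambda>x i. x \<in> P)"
  define R' where "R' x y \<longleftrightarrow> (\<exists>a\<le>x. \<exists>i\<le>x. \<exists>b\<le>y. \<exists>j\<le>y. x = cpair a i \<and> y = cpair b j \<and> (a, b) \<in> r \<and> i \<le> j)" for x y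
  have "P' \<in> S" unfolding P'_def using PL by (intro pairs_comprehension definable_intros)
  have "pairs_of R' \<in> S" unfolding R'_def r_def using PL
    by (intro pairs_comprehension definable_intros)
  have R'_cpair: "R' (cpair a i) (cpair b j)" if "(a, b) \<in> r" "i \<le> j" for a i b j
    unfolding R'_def
    by (rule exI[of _ a], rule conjI, rule cpair_ge(1), rule exI[of _ i], rule conjI, rule cpair_ge(2),
        rule exI[of _ b], rule conjI, rule cpair_ge(1), rule exI[of _ j], rule conjI, rule cpair_ge(2))
      (simp add: that)
  have R': "{(x, y). R' x y} = {(cpair a i, cpair b j) | a i b j. (a, b) \<in> r \<and> i \<le> j}"
  proof (intro set_eqI iffI)
    fix z assume "z \<in> {(x, y). R' x y}"
    then show "z \<in> {(cpair a i, cpair b j) | a i b j. (a, b) \<in> r \<and> i \<le> j}"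
      unfolding R'_def by blast
  qed (use R'_cpair in auto)
  have P': "P' = {cpair a i | a i. a \<in> P}" by (auto simp: P'_def pairs_of_def)
  have po': "partial_order_on P' {(x, y). R' x y}"
    unfolding partial_order_on_def preorder_on_def R' P'
  proof (intro conjI)
    show "{(cpair a i, cpair b j) | a i b j. (a, b) \<in> r \<and> i \<le> j} \<subseteq> 
      {cpair a i | a i. a \<in> P} \<times> {cpair a i | a i. a \<in> P}" using r(1) by blast
    show "refl_on {cpair a i |a i. a \<in> P} {(cpair a i, cpair b j) |a i b j. (a, b) \<in> r \<and> i \<le> j}"
      using r(2) by (auto simp: refl_on_def)
    show "trans {(cpair a i, cpair b j) |a i b j. (a, b) \<in> r \<and> i \<le> j}"
    proof (rule transI, clarsimp)
      show "(a, c) \<in> r \<and> i \<le> l" if "(a, b) \<in> r" "i \<le> j" "(b, c) \<in> r" "j \<le> l" for a b c and i j l :: 'a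
        using that transD[OF r(4)] by auto
    qed
    show "antisym {(cpair a i, cpair b j) |a i b j. (a, b) \<in> r \<and> i \<le> j}"
      using antisymD[OF r(3)] by (auto intro!: antisymI)
  qed
  have less_R': "po_less (P', {(x, y). R' x y}) (cpair a i) (cpair b j) \<Longrightarrow> (a, b) \<in> r \<and> i \<le> j" for a i b j
    unfolding po_less_def R' by auto
  have "omega_plus_omega_star_like (P', {(x, y). R' x y})"
    unfolding omega_plus_omega_star_like_def
  proof (intro ballI disjI1)
    fix y assume "y \<in> fst (P', {(x, y). R' x y})"
    then obtain b j where y: "y = cpair b j" "b \<in> P" by (auto simp: P')
    obtain m where m: "\<And>c. (c, b) \<in> r \<Longrightarrow> c \<noteq> b \<Longrightarrow> c < m"
      using like r(1) y(2) unfolding omega_like_def fin_def predecessors_def po_less_def r_def by fastforce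
    have "z < cpair (m + b + 1) j" if less: "po_less (P', {(x, y). R' x y}) z y" for z
    proof -
      obtain a i where z: "z = cpair a i" "a \<in> P" using less by (auto simp: po_less_def P')
      then have "(a, b) \<in> r" "i \<le> j" using less less_R' y by blast+
      moreover have "a \<le> m + b"
        using m[OF \<open>(a, b) \<in> r\<close>] by (cases "a = b") (auto intro: less_imp_le add_increasing2)
      ultimately have "a + i < m + b + 1 + j"
        by (metis add.commute add.left_commute add_mono less_eq_iff_succ_less)
      then show ?thesis unfolding z by (rule cpair_less_cpair)
    qed
    then show "fin (predecessors (P', {(x, y). R' x y}) y)"
      unfolding fin_def predecessors_def by blast
  qed
  then have "embeds_into S (P', {(x, y). R' x y}) omega_plus_omega_star"
    using assms[unfolded omega_plus_omega_star_embeddable_def embeddable_def, rule_format,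
        of P' "pairs_of R'"] po' \<open>P' \<in> S\<close> \<open>pairs_of R' \<in> S\<close> by simp
  then obtain f where def: "definable S (\<lambda>e. e 0 \<in> P' \<and> f (e 0) = e 1)" and inj: "inj_on f P'"
    and range: "\<And>x. x \<in> P' \<Longrightarrow> f x \<in> fst omega_plus_omega_star"
    and mono: "\<And>x y. (x, y) \<in> {(x, y). R' x y} \<Longrightarrow> x \<in> P' \<Longrightarrow> y \<in> P' \<Longrightarrow> (f x, f y) \<in> snd omega_plus_omega_star"
    by (rule embeds_intoE) (rule that)
  define h where "h = pairs_of (\<lambda>x y. x \<in> P' \<and> f x = y)"
  have "h \<in> S" unfolding h_def using def by (intro pairs_comprehension)
  have h: "(x, y) \<in> rel_of h \<longleftrightarrow> x \<in> P' \<and> f x = y" for x y by (simp add: h_def)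
  have "\<exists>v. f (cpair x 0) = cpair 0 v" if "x \<in> P" for x
  proof (rule ccontr)
    assume no: "\<not> ?thesis"
    have in_P': "cpair x i \<in> P'" for i using that by (auto simp: P')
    obtain k where k: "f (cpair x 0) = cpair 1 k"
      using range[OF in_P'[of 0]] no by (auto elim: omega_plus_omega_star_cases)
    have step: "(f (cpair x i), f (cpair x j)) \<in> snd omega_plus_omega_star" if "i \<le> j" for i j
      using that r(2)[OF \<open>x \<in> P\<close>] in_P' unfolding R' by (intro mono) (auto simp: R')
    have in_part1: "\<exists>l\<le>k. f (cpair x i) = cpair 1 l" for i
      using step[of 0 i] range[OF in_P'[of i]] k by (auto elim!: omega_plus_omega_star_cases)
    \<comment> \<open>Each step up the chain lowers the position in \<open>\<omega>\<^sup>*\<close>, which is impossible after \<open>k + 1\<close> steps.\<close>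
    have "definable S (\<lambda>e. \<forall>l\<le>k. (cpair x (e 0), cpair 1 l) \<in> rel_of h \<longrightarrow> l + e 0 \<le> k)"
      by (intro definable_intros \<open>h \<in> S\<close>)
    then have "\<forall>l\<le>k. (cpair x i, cpair 1 l) \<in> rel_of h \<longrightarrow> l + i \<le> k" for i
    proof (induction i rule: bounded_induction)
      case 0
      then show ?case by simp
    next
      case (Suc i)
      show ?case
      proof (intro allI impI)
        fix l assume "l \<le> k" and "(cpair x (i + 1), cpair 1 l) \<in> rel_of h"
        then have l: "f (cpair x (i + 1)) = cpair 1 l" by (simp add: h)
        obtain l' where l': "l' \<le> k" "f (cpair x i) = cpair 1 l'" using in_part1 by blast
        then have "l' + i \<le> k" using Suc in_P' by (auto simp: h)
        moreover have "l \<le> l'" using step[of i "i + 1"] l l' by simp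
        moreover have "f (cpair x i) \<noteq> f (cpair x (i + 1))"
          using inj_onD[OF inj _ in_P' in_P', of i "i + 1"] by auto
        then have "l \<noteq> l'" using l l' by auto
        ultimately have "l + 1 \<le> l'" unfolding less_iff_succ_less_eq[symmetric] by simp
        then have "l + 1 + i \<le> k" using \<open>l' + i \<le> k\<close> by (meson add_right_mono order_trans)
        then show "l + (i + 1) \<le> k" by (simp add: ac_simps)
      qed
    qed
    then have "\<exists>l. l + (k + 1) \<le> k" using in_part1[of "k + 1"] in_P' h by blast
    then obtain l where "k + 1 + l \<le> k + 0" by (auto simp: ac_simps)
    then show False unfolding add.assoc add_le_cancel_left by simp
  qed
  then obtain g where g: "\<And>x. x \<in> P \<Longrightarrow> f (cpair x 0) = cpair 0 (g x)" by metis
  have g_eq: "x \<in> P \<and> g x = v \<longleftrightarrow> x \<in> P \<and> (cpair x 0, cpair 0 v) \<in> rel_of h" for x v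
    using g[of x] unfolding h by (auto simp: P')
  show "embeds_into S (P, rel_of L) omega"
  proof (rule embeds_intoI)
    show "definable S (\<lambda>e. e 0 \<in> P \<and> g (e 0) = e 1)"
      unfolding g_eq by (intro definable_intros PL \<open>h \<in> S\<close>)
    show "inj_on g P"
    proof (rule inj_onI)
      fix x y assume "x \<in> P" "y \<in> P" "g x = g y"
      then have "f (cpair x 0) = f (cpair y 0)" using g by metis
      then show "x = y" using inj_onD[OF inj] \<open>x \<in> P\<close> \<open>y \<in> P\<close> by (fastforce simp: P')
    qed
    show "g x \<in> fst omega" for x by (simp add: omega_def)
    show "(g x, g y) \<in> snd omega" if "(x, y) \<in> rel_of L" "x \<in> P" "y \<in> P" for x y
    proof -
      have "(f (cpair x 0), f (cpair y 0)) \<in> snd omega_plus_omega_star"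
        using that unfolding R' by (intro mono) (auto simp: r_def R' P')
      then show ?thesis using g that by (simp add: omega_def)
    qed
  qed
qed

end

section \<open>From embeddability to arithmetical comprehension\<close>

text \<open>
  The point \<open>(n, 0)\<close> waits for a witness of \<open>\<exists>x. R n x\<close>. If \<open>x\<close> is the least witness, then the
  \<open>x + 1\<close> points \<open>(n, j)\<close> with \<open>x < j \<le> 2 x + 1\<close> form a chain below it; all other points are
  isolated. Since \<open>j\<close> exceeds \<open>x\<close>, the order is definable by bounded formulas. An embedding sends
  the top of the chain to a number that is at least \<open>x\<close>, so it bounds the search for \<open>x\<close>.
\<close>

lemma (in rca0_model) Sigma01_comprehension_if_omega_embeddable:
  assumes emb: "omega_embeddable S" and R: "definable S (\<lambda>e. R (e 0) (e 1))"
  shows "{n. \<exists>x. R n x} \<in> S"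
proof -
  note R_intro = definable_subst[OF R]
  define W where "W n x \<longleftrightarrow> R n x \<and> (\<forall>y<x. \<not> R n y)" for n x
  have "definable S (\<lambda>e. W (e 0) (e 1))" unfolding W_def by (intro definable_intros R_intro)
  note W_intro = definable_subst[OF this]
  have W_unique: "x = y" if "W n x" "W n y" for n x y
    using that by (cases x y rule: linorder_cases) (auto simp: W_def)
  define chain where "chain n j \<longleftrightarrow> (\<exists>x<j. W n x \<and> j \<le> x + x + 1)" for n j
  have "definable S (\<lambda>e. chain (e 0) (e 1))" unfolding chain_def by (intro definable_intros W_intro)
  note chain_intro = definable_subst[OF this]
  have not_chain_0 [simp]: "\<not> chain n 0" for n by (simp add: chain_def)
  define below where "below n i j \<longleftrightarrow> i = j \<or> chain n i \<and> (j = 0 \<or> chain n j \<and> i < j)" for n i j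
  define P where "P = pairs_of (\<lambda>(n::'a) (j::'a). True)"
  define Q where "Q z w \<longleftrightarrow> (\<exists>n\<le>z. \<exists>i\<le>z. \<exists>j\<le>w. z = cpair n i \<and> w = cpair n j \<and> below n i j)" for z w
  have "P \<in> S" unfolding P_def by (intro pairs_comprehension) (use definable_Eq_Less(1)[of "\<lambda>_. 0" "\<lambda>_. 0"] in \<open>simp add: definable_intros\<close>)
  have "pairs_of Q \<in> S" unfolding Q_def below_def
    by (intro pairs_comprehension definable_intros chain_intro)
  have P: "P = {cpair n j | n j. True}" by (auto simp: P_def pairs_of_def)
  have Q_cpair: "Q (cpair n i) (cpair n j)" if "below n i j" for n i j
    unfolding Q_def
    by (rule exI[of _ n], rule conjI, rule cpair_ge(1), rule exI[of _ i], rule conjI, rule cpair_ge(2),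
        rule exI[of _ j], rule conjI, rule cpair_ge(2)) (simp add: that)
  have Q: "{(z, w). Q z w} = {(cpair n i, cpair n j) | n i j. below n i j}"
  proof (intro set_eqI iffI)
    fix u assume "u \<in> {(z, w). Q z w}"
    then show "u \<in> {(cpair n i, cpair n j) | n i j. below n i j}" unfolding Q_def by blast
  qed (use Q_cpair in auto)
  have "partial_order_on P {(z, w). Q z w}"
    unfolding partial_order_on_def preorder_on_def Q P
  proof (intro conjI)
    show "refl_on {cpair n j |n j. True} {(cpair n i, cpair n j) |n i j. below n i j}"
      by (auto simp: refl_on_def below_def)
    show "trans {(cpair n i, cpair n j) |n i j. below n i j}"
    proof (rule transI, clarsimp)
      show "below n i k" if "below n i j" "below n j k" for n i j k
        using that by (auto simp: below_def)
    qed
    show "antisym {(cpair n i, cpair n j) |n i j. below n i j}"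
      by (rule antisymI) (auto simp: below_def)
  qed auto
  moreover have "omega_like (P, {(z, w). Q z w})"
    unfolding omega_like_def
  proof
    fix w assume "w \<in> fst (P, {(z, w). Q z w})"
    then obtain n j where w: "w = cpair n j" by (auto simp: P)
    show "fin (predecessors (P, {(z, w). Q z w}) w)"
    proof (cases "\<exists>x. W n x")
      case True
      then obtain x where x: "W n x" by blast
      have "z < cpair n (x + x + 1 + 1)" if less: "po_less (P, {(z, w). Q z w}) z w" for z
      proof -
        obtain i where z: "z = cpair n i" "chain n i"
          using less w unfolding po_less_def Q by (auto simp: below_def)
        then have "i \<le> x + x + 1" using W_unique[OF x] by (auto simp: chain_def)
        then have "n + i < n + (x + x + 1 + 1)"
          using less_eq_iff_succ_less[of i "x + x + 1"] by simp
        then show ?thesis unfolding z by (rule cpair_less_cpair)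
      qed
      then show ?thesis unfolding predecessors_def fin_def by blast
    next
      case False
      then have "\<not> po_less (P, {(z, w). Q z w}) z w" for z
        unfolding po_less_def Q using w by (auto simp: below_def chain_def)
      then show ?thesis by (simp add: predecessors_def fin_def)
    qed
  qed
  ultimately have "embeds_into S (P, {(z, w). Q z w}) omega"
    using emb[unfolded omega_embeddable_def embeddable_def, rule_format, of P "pairs_of Q"]
      \<open>P \<in> S\<close> \<open>pairs_of Q \<in> S\<close> by simp
  then obtain f where def: "definable S (\<lambda>e. e 0 \<in> P \<and> f (e 0) = e 1)" and inj: "inj_on f P"
    and mono: "\<And>x y. (x, y) \<in> {(x, y). Q x y} \<Longrightarrow> x \<in> P \<Longrightarrow> y \<in> P \<Longrightarrow> (f x, f y) \<in> snd omega"
    by (rule embeds_intoE) (rule that)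
  define h where "h = pairs_of (\<lambda>x y. x \<in> P \<and> f x = y)"
  have "h \<in> S" unfolding h_def using def by (intro pairs_comprehension)
  have in_P: "cpair n j \<in> P" for n j by (auto simp: P)
  have h: "(cpair n j, y) \<in> rel_of h \<longleftrightarrow> f (cpair n j) = y" for n j y using in_P by (simp add: h_def)
  have f_mono: "f (cpair n i) \<le> f (cpair n j)" if "below n i j" for n i j
    using mono[of "cpair n i" "cpair n j"] Q_cpair[OF that] in_P by (simp add: omega_def)
  have witness_bound: "x \<le> f (cpair n 0)" if x: "W n x" for n x
  proof -
    have in_chain: "chain n (x + 1 + i)" if "i \<le> x" for i
      unfolding chain_def
    proof (intro exI[of _ x] conjI)
      show "x < x + 1 + i" using less_iff_succ_less_eq[of x "x + 1 + i"] by simp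
      show "x + 1 + i \<le> x + x + 1" using add_left_mono[OF that, of "x + 1"] by (simp add: ac_simps)
    qed (rule x)
    have "definable S (\<lambda>e. e 0 \<le> x \<longrightarrow> (\<forall>v<e 0. (cpair n (x + 1 + e 0), v) \<notin> rel_of h))"
      by (intro definable_intros \<open>h \<in> S\<close>)
    then have "i \<le> x \<longrightarrow> (\<forall>v<i. (cpair n (x + 1 + i), v) \<notin> rel_of h)" for i
    proof (induction i rule: bounded_induction)
      case 0
      then show ?case by simp
    next
      case (Suc i)
      show ?case
      proof (intro impI)
        assume "i + 1 \<le> x"
        then have "i < x" by (simp add: less_iff_succ_less_eq)
        let ?u = "f (cpair n (x + 1 + i))" and ?v = "f (cpair n (x + 1 + (i + 1)))"
        have "i \<le> ?u" using Suc \<open>i < x\<close> by (auto simp: h not_less[symmetric])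
        moreover have "?u \<le> ?v"
          using in_chain \<open>i < x\<close> \<open>i + 1 \<le> x\<close> by (intro f_mono) (simp add: below_def less_add_one)
        moreover have "?u \<noteq> ?v"
          using inj_onD[OF inj _ in_P in_P, of n "x + 1 + i" n "x + 1 + (i + 1)"] by auto
        ultimately have "i < ?v" by simp
        then have "i + 1 \<le> ?v" by (simp add: less_iff_succ_less_eq)
        then show "\<forall>v<i + 1. (cpair n (x + 1 + (i + 1)), v) \<notin> rel_of h"
          by (auto simp: h not_less[symmetric])
      qed
    qed
    then have "x \<le> f (cpair n (x + 1 + x))" by (auto simp: h not_less[symmetric])
    also have "\<dots> \<le> f (cpair n 0)" using in_chain by (intro f_mono) (simp add: below_def)
    finally show ?thesis .
  qed
  have "R n x \<Longrightarrow> \<exists>y\<le>f (cpair n 0). R n y" for n x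
  proof -
    assume "R n x"
    moreover have "definable S (\<lambda>e. R n (e 0))" by (intro definable_intros R_intro)
    ultimately obtain y where "W n y" using ex_least[of "R n" x] by (auto simp: W_def)
    then show ?thesis using witness_bound by (auto simp: W_def)
  qed
  then have eq: "(\<exists>x. R n x) \<longleftrightarrow> (\<exists>y\<le>f (cpair n 0). R n y)" for n by blast
  have "{n. \<exists>v. (cpair n 0, v) \<in> rel_of h \<and> (\<exists>y\<le>v. R n y)} \<in> S"
  proof (rule Delta01_comprehension_rule)
    show "definable S (\<lambda>e. (cpair (e 0) 0, e 1) \<in> rel_of h \<and> (\<exists>y\<le>e 1. R (e 0) y))"
      by (intro definable_intros R_intro \<open>h \<in> S\<close>)
    show "definable S (\<lambda>e. (cpair (e 0) 0, e 1) \<in> rel_of h \<longrightarrow> (\<exists>y\<le>e 1. R (e 0) y))"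
      by (intro definable_intros R_intro \<open>h \<in> S\<close>)
  qed (simp add: h)
  then show ?thesis by (simp add: h eq)
qed

text \<open>
  By \<open>ACA0_iff_sigma01_model\<close> below, these are exactly the models of arithmetical comprehension.
\<close>

locale sigma01_model = rca0_model +
  assumes Sigma01_comprehension: "definable S (\<lambda>e. R (e 0) (e 1)) \<Longrightarrow> {n. \<exists>x. R n x} \<in> S"

lemma definable_finite_dependence:
  assumes "definable S R"
  shows "\<exists>K. \<forall>e e'. (\<forall>n<K. e n = e' n) \<longrightarrow> (R e \<longleftrightarrow> R e')"
proof -
  obtain p c s where p: "\<And>e. sat S (interleave e c) s p \<longleftrightarrow> R e"
    using assms unfolding definable_def by blast
  from sat_finite_dependence[of S p] obtain K where
    K: "\<forall>e e'. (\<forall>n<K. e n = e' n) \<longrightarrow> (\<forall>s. sat S e s p \<longleftrightarrow> sat S e' s p)" ..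
  have "R e \<longleftrightarrow> R e'" if "\<forall>n<K. e n = e' n" for e e'
  proof -
    have "\<forall>n<K. interleave e c n = interleave e' c n"
      using that by (simp add: interleave_def)
    then have "sat S (interleave e c) s p \<longleftrightarrow> sat S (interleave e' c) s p"
      using K[rule_format, of "interleave e c" "interleave e' c" s] by blast
    then show ?thesis unfolding p .
  qed
  then show ?thesis by (intro exI[of _ K]) blast
qed

text \<open>
  All arguments but one are turned into parameters; odd variables \<open>2 n + 1\<close> take over the role of
  the old variables \<open>n\<close>.
\<close>

lemma definable_instantiate:
  assumes "definable S R"
  shows "definable S (\<lambda>e'. R (e(x := e' 0)))"
proof -
  obtain p c s where p: "bounded_fm p" "range s \<subseteq> S" "\<And>e. sat S (interleave e c) s p \<longleftrightarrow> R e"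
    using assms unfolding definable_def by blast
  define \<rho> where "\<rho> n = (if n = 2 * x then 0 else Suc (2 * n))" for n
  have "inj \<rho>" by (auto simp: inj_def \<rho>_def)
  have "interleave e' (interleave e c) \<circ> \<rho> = interleave (e(x := e' 0)) c" for e'
  proof
    fix n
    show "(interleave e' (interleave e c) \<circ> \<rho>) n = interleave (e(x := e' 0)) c n"
      by (cases "n = 2 * x") (auto simp: \<rho>_def interleave_def[of e'], auto simp: interleave_def)
  qed
  then have "\<forall>e'. sat S (interleave e' (interleave e c)) s (rename_fm \<rho> id p) \<longleftrightarrow> R (e(x := e' 0))"
    using p(3) \<open>inj \<rho>\<close> by (simp add: sat_rename)
  then show ?thesis unfolding definable_def using bounded_rename[OF p(1) \<open>inj \<rho>\<close>] p(2) by blast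
qed

context sigma01_model
begin

text \<open>
  \<open>\<Sigma>\<^sup>0\<^sub>1\<close> comprehension removes the quantifier from a relation with one argument besides the
  quantified variable. With more arguments, the first two are replaced by the code of their pair, and
  the claim is applied to the resulting relation \<open>Q2\<close>, which has one argument less.
\<close>

lemma definable_Ex_aux:
  assumes "definable S Q" "\<And>e e'. (\<forall>n<K + 2. e n = e' n) \<Longrightarrow> Q e \<longleftrightarrow> Q e'"
  shows "definable S (\<lambda>e. \<exists>a. Q (case_nat a e))"
  using assms
proof (induction K arbitrary: Q)
  case 0
  let ?\<rho> = "\<lambda>n::nat. if n = 0 then 1 else if n = 1 then 0 else n"
  have dep: "Q e \<longleftrightarrow> Q e'" if "e 0 = e' 0" "e 1 = e' 1" for e e'
    using that by (intro 0(2)) (auto simp: less_Suc_eq)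
  have "inj ?\<rho>" by (auto simp: inj_def)
  then have "definable S (\<lambda>e. Q (e \<circ> ?\<rho>))" by (intro definable_rename 0(1))
  also have "(\<lambda>e. Q (e \<circ> ?\<rho>)) = (\<lambda>e. Q (case_nat (e 1) (\<lambda>_. e 0)))"
    by (intro ext dep) auto
  finally have "{n. \<exists>a. Q (case_nat a (\<lambda>_. n))} \<in> S" by (intro Sigma01_comprehension)
  then have "definable S (\<lambda>e. e 0 \<in> {n. \<exists>a. Q (case_nat a (\<lambda>_. n))})"
    by (intro definable_intros)
  also have "(\<lambda>e. e 0 \<in> {n. \<exists>a. Q (case_nat a (\<lambda>_. n))}) = (\<lambda>e. \<exists>a. Q (case_nat a e))"
  proof
    fix e :: "nat \<Rightarrow> 'a"
    have "Q (case_nat a (\<lambda>_. e 0)) \<longleftrightarrow> Q (case_nat a e)" for a by (intro dep) auto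
    then show "(e 0 \<in> {n. \<exists>a. Q (case_nat a (\<lambda>_. n))}) = (\<exists>a. Q (case_nat a e))" by simp
  qed
  finally show ?case .
next
  case (Suc K)
  define Q2 where "Q2 e \<longleftrightarrow> (\<exists>v\<le>e 1. \<exists>w\<le>e 1. e 1 = cpair v w \<and>
    Q (case_nat (e 0) (case_nat v (case_nat w (\<lambda>n. e (Suc (Suc n)))))))" for e
  have "definable S Q2"
  proof -
    \<comment> \<open>Under the two bounded quantifiers, the indices 0, 1, 2, 3 stand for \<open>w\<close>, \<open>v\<close>, \<open>a\<close> and the code.\<close>
    define \<rho> :: "nat \<Rightarrow> nat" where
      "\<rho> = case_nat 2 (case_nat 1 (case_nat 0 (\<lambda>n. Suc (Suc (Suc (Suc n))))))"
    have "inj \<rho>" by (auto simp: inj_def \<rho>_def split: nat.splits)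
    then have "definable S (\<lambda>e. Q (e \<circ> \<rho>))" by (intro definable_rename Suc.prems(1))
    moreover have "e \<circ> \<rho> = case_nat (e 2) (case_nat (e 1) (case_nat (e 0) (\<lambda>n. e (Suc (Suc (Suc (Suc n)))))))" for e :: "nat \<Rightarrow> 'a"
      by (auto simp: fun_eq_iff \<rho>_def split: nat.splits)
    ultimately have "definable S (\<lambda>e. Q (case_nat (e 2) (case_nat (e 1) (case_nat (e 0) (\<lambda>n. e (Suc (Suc (Suc (Suc n)))))))))"
      by simp
    then show ?thesis unfolding Q2_def by (intro definable_intros) (simp add: numeral_2_eq_2)
  qed
  moreover have "Q2 e \<longleftrightarrow> Q2 e'" if "\<forall>n<K + 2. e n = e' n" for e e'
  proof -
    have "Q (case_nat (e 0) (case_nat v (case_nat w (\<lambda>n. e (Suc (Suc n)))))) \<longleftrightarrow>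
        Q (case_nat (e' 0) (case_nat v (case_nat w (\<lambda>n. e' (Suc (Suc n))))))" for v w
      using that by (intro Suc.prems(2)) (auto split: nat.splits)
    then show ?thesis unfolding Q2_def using that by simp
  qed
  ultimately have "definable S (\<lambda>e. \<exists>a. Q2 (case_nat a e))" by (rule Suc.IH)
  then have "definable S (\<lambda>e. \<exists>a. Q2 (case_nat a (e \<circ> case_nat 0 (\<lambda>n. Suc (Suc (Suc n))))))"
    by (rule definable_rename) (auto simp: inj_def split: nat.splits)
  moreover have "(e \<circ> case_nat 0 (\<lambda>n. Suc (Suc (Suc n)))) = case_nat (e 0) (\<lambda>n. e (Suc (Suc (Suc n))))" for e :: "nat \<Rightarrow> 'a"
    by (auto simp: fun_eq_iff split: nat.splits)
  ultimately have Q2: "definable S (\<lambda>e. \<exists>a. Q2 (case_nat a (case_nat (e 0) (\<lambda>n. e (Suc (Suc (Suc n)))))))"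
    by simp
  \<comment> \<open>The code of the pair is substituted for the first argument of \<open>\<exists>a. Q2\<close>.\<close>
  have "definable S (\<lambda>e. \<exists>c. c \<le> cpair (e 0) (e 1) \<and> (c = cpair (e 0) (e 1) \<and>
     (\<exists>a. Q2 (case_nat a (case_nat c (\<lambda>n. e (Suc (Suc n))))))))"
    by (intro definable_bounded_Ex_le definable_Conj definable_Eq_Less definable_tm_cpair
        definable_tm_Var Q2)
  moreover have "Q2 (case_nat a (case_nat (cpair (e 0) (e 1)) (\<lambda>n. e (Suc (Suc n))))) \<longleftrightarrow> Q (case_nat a e)" for a e
  proof -
    have e: "case_nat (e 0) (case_nat (e 1) (\<lambda>n. e (Suc (Suc n)))) = e"
      by (auto simp: fun_eq_iff split: nat.splits)
    have "Q2 (case_nat a (case_nat (cpair (e 0) (e 1)) (\<lambda>n. e (Suc (Suc n))))) \<longleftrightarrow>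
       Q (case_nat a (case_nat (e 0) (case_nat (e 1) (\<lambda>n. e (Suc (Suc n))))))"
      unfolding Q2_def by (auto simp: cpair_ge)
    then show ?thesis unfolding e .
  qed
  ultimately show ?case by simp
qed

lemma definable_Ex:
  assumes "definable S (\<lambda>e. R (\<lambda>n. e (Suc n)) (e 0))"
  shows "definable S (\<lambda>e. \<exists>a. R e a)"
proof -
  obtain K where K: "\<And>e e'. (\<forall>n<K. e n = e' n) \<Longrightarrow>
      R (\<lambda>n. e (Suc n)) (e 0) \<longleftrightarrow> R (\<lambda>n. e' (Suc n)) (e' 0)"
    using definable_finite_dependence[OF assms] by blast
  have "definable S (\<lambda>e. \<exists>a. R (\<lambda>n. case_nat a e (Suc n)) (case_nat a e 0))"
    by (rule definable_Ex_aux[OF assms, where K = K]) (rule K, simp)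
  then show ?thesis by simp
qed

lemma definable_All:
  assumes "definable S (\<lambda>e. R (\<lambda>n. e (Suc n)) (e 0))"
  shows "definable S (\<lambda>e. \<forall>a. R e a)"
proof -
  have "definable S (\<lambda>e. \<not> (\<exists>a. \<not> R e a))" by (intro definable_Neg definable_Ex assms)
  then show ?thesis by simp
qed

lemma definable_tm_val: "definable_tm (\<lambda>e. tm_val e t)"
  by (induction t) (simp_all add: definable_intros)

text \<open>
  Unbounded number quantifiers do not lead out of the definable relations, so every arithmetical
  formula defines one.
\<close>

lemma definable_sat:
  assumes "arithmetical_fm p" "range s \<subseteq> S"
  shows "definable S (\<lambda>e. sat S e s p)"
  using assms(1)
proof (induction p)
  case (AllN x p)
  let ?\<rho> = "\<lambda>n. if n = x then 0 else Suc n"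
  have "definable S (\<lambda>e. sat S (e \<circ> ?\<rho>) s p)"
    using AllN by (intro definable_rename) (auto simp: inj_def)
  moreover have "e \<circ> ?\<rho> = (\<lambda>n. e (Suc n))(x := e 0)" for e :: "nat \<Rightarrow> 'a" by auto
  ultimately have "definable S (\<lambda>e. sat S ((\<lambda>n. e (Suc n))(x := e 0)) s p)" by simp
  then show ?case by (simp add: definable_All[of "\<lambda>e a. sat S (e(x := a)) s p"])
next
  case (ExN x p)
  let ?\<rho> = "\<lambda>n. if n = x then 0 else Suc n"
  have "definable S (\<lambda>e. sat S (e \<circ> ?\<rho>) s p)"
    using ExN by (intro definable_rename) (auto simp: inj_def)
  moreover have "e \<circ> ?\<rho> = (\<lambda>n. e (Suc n))(x := e 0)" for e :: "nat \<Rightarrow> 'a" by auto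
  ultimately have "definable S (\<lambda>e. sat S ((\<lambda>n. e (Suc n))(x := e 0)) s p)" by simp
  then show ?case by (simp add: definable_Ex[of "\<lambda>e a. sat S (e(x := a)) s p"])
next
  case (Mem t X)
  have "s X \<in> S" using assms(2) by auto
  then show ?case by (simp add: definable_Mem definable_tm_val)
qed (simp_all add: definable_intros definable_tm_val)

lemma arithmetical_comprehension: "arithmetical_comprehension S"
  unfolding arithmetical_comprehension_def
proof (intro allI impI, elim conjE)
  fix p x e and s :: "nat \<Rightarrow> 'a set"
  assume "arithmetical_fm p" "range s \<subseteq> S"
  then have "definable S (\<lambda>e'. sat S (e(x := e' 0)) s p)"
    by (intro definable_instantiate definable_sat)
  then show "{n. sat S (e(x := n)) s p} \<in> S" by (rule bounded_comprehension)
qed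

end

lemma arithmetical_if_bounded: "bounded_fm p \<Longrightarrow> arithmetical_fm p"
  by (induction rule: bounded_fm.induct) auto

lemma ACA0_iff_sigma01_model: "ACA0 S \<longleftrightarrow> sigma01_model S"
proof
  assume "ACA0 S"
  then have S: "RCA0 S" "arithmetical_comprehension S" by (simp_all add: ACA0_def)
  interpret rca0_model S using S(1) by unfold_locales
  show "sigma01_model S"
  proof
    fix R assume "definable S (\<lambda>e. R (e 0) (e 1))"
    then obtain p c s where *:
      "bounded_fm p" "range s \<subseteq> S" "\<forall>e. sat S (interleave e c) s p \<longleftrightarrow> R (e 0) (e 1)"
      unfolding definable_def by blast
    have "{n. sat S ((interleave (\<lambda>_. 0) c)(0 := n)) s (ExN 2 p)} \<in> S"
      using S(2)[unfolded arithmetical_comprehension_def, rule_format, of "ExN 2 p" s _ 0]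
        *(2) arithmetical_if_bounded[OF *(1)] by simp
    then show "{n. \<exists>x. R n x} \<in> S" using *(3) by (simp add: interleave_upd)
  qed
next
  assume "sigma01_model S"
  then interpret sigma01_model S .
  show "ACA0 S" unfolding ACA0_def using rca0 arithmetical_comprehension by blast
qed

section \<open>Embeddings from arithmetical comprehension\<close>

text \<open>
  The moduli of Goedel's \<open>\<beta>\<close>-function.
\<close>

definition modulus :: "'a::discretely_ordered_semiring \<Rightarrow> 'a \<Rightarrow> 'a" where
  "modulus b i = 1 + (i + 1) * b"

text \<open>
  Distinct moduli are coprime, in the form of a cancellation rule, which passes easily to
  products. With \<open>m\<^sub>i\<close> for \<open>modulus b i\<close>, the numbers \<open>m\<^sub>i (j + 1)\<close> and \<open>m\<^sub>j (i + 1)\<close>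
  differ by the distance of \<open>i\<close> and \<open>j\<close>, which divides \<open>b\<close>. So \<open>m\<^sub>j\<close> divides \<open>b c\<close>, and \<open>b\<close> can
  be cancelled because \<open>(j + 1) b = m\<^sub>j - 1\<close>.
\<close>

lemma modulus_cancel:
  fixes b :: "'a::discretely_ordered_semiring"
  assumes b: "\<And>i. i < N \<Longrightarrow> i + 1 dvd b" and ij: "i \<noteq> j" "i < N" "j < N"
    and dvd: "modulus b j dvd modulus b i * c"
  shows "modulus b j dvd c"
proof -
  let ?m = "modulus b"
  \<comment> \<open>The distance is written as \<open>d + 1\<close> because the divisors that \<open>b\<close> is known to have are successors.\<close>
  have "\<exists>d. d + 1 dvd b \<and> (?m i * (j + 1) = ?m j * (i + 1) + (d + 1) \<or>
      ?m j * (i + 1) = ?m i * (j + 1) + (d + 1))"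
  proof (cases i j rule: linorder_cases)
    case less
    then have "i + 1 \<le> j" by (simp add: less_iff_succ_less_eq)
    then obtain d where d: "j = i + 1 + d" by (auto simp: le_iff_add)
    then have "d \<le> j" unfolding d by simp
    then have "d < N" using ij by auto
    moreover have "?m i * (j + 1) = ?m j * (i + 1) + (d + 1)"
      by (simp add: modulus_def d algebra_simps)
    ultimately show ?thesis using b by blast
  next
    case greater
    then have "j + 1 \<le> i" by (simp add: less_iff_succ_less_eq)
    then obtain d where d: "i = j + 1 + d" by (auto simp: le_iff_add)
    then have "d \<le> i" unfolding d by simp
    then have "d < N" using ij by auto
    moreover have "?m j * (i + 1) = ?m i * (j + 1) + (d + 1)"
      by (simp add: modulus_def d algebra_simps)
    ultimately show ?thesis using b by blast
  qed (use ij in simp)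
  then obtain d where d: "d + 1 dvd b" and
    eq: "?m i * (j + 1) = ?m j * (i + 1) + (d + 1) \<or> ?m j * (i + 1) = ?m i * (j + 1) + (d + 1)"
    by blast
  have 1: "?m j dvd ?m i * (j + 1) * c"
    using dvd_mult2[OF dvd, of "j + 1"] by (simp only: ac_simps)
  have 2: "?m j dvd ?m j * (i + 1) * c" by (simp add: ac_simps)
  have "?m j dvd (d + 1) * c"
    using eq
  proof
    assume eq: "?m i * (j + 1) = ?m j * (i + 1) + (d + 1)"
    show ?thesis using 1 unfolding eq distrib_right[of _ "d + 1"] dvd_add_right_iff[OF 2] .
  next
    assume eq: "?m j * (i + 1) = ?m i * (j + 1) + (d + 1)"
    show ?thesis using 2 unfolding eq distrib_right[of _ "d + 1"] dvd_add_right_iff[OF 1] .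
  qed
  moreover obtain k where "b = (d + 1) * k" using d by blast
  ultimately have "?m j dvd (j + 1) * b * c"
    by (metis dvd_mult mult.assoc mult.commute)
  moreover have "?m j * c = (j + 1) * b * c + c"
    by (simp add: modulus_def algebra_simps)
  ultimately show ?thesis by (metis dvd_add_right_iff dvd_triv_left)
qed

lemma modulus_not_dvd_one:
  assumes "0 < b"
  shows "\<not> modulus b i dvd 1"
proof
  assume "modulus b i dvd 1"
  then obtain k where k: "1 = modulus b i * k" by blast
  then have "0 < k" by (cases "k = 0") (auto simp: zero_less_iff_neq_zero)
  then have "1 \<le> k" using less_iff_succ_less_eq[of 0 k] by simp
  then have "modulus b i * 1 \<le> modulus b i * k" by (intro mult_left_mono) auto
  then have "modulus b i \<le> 1" using k by simp
  moreover have "0 < (i + 1) * b" using assms by (intro mult_pos_pos) (auto simp: zero_less_iff_neq_zero)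
  ultimately show False by (simp add: modulus_def zero_less_iff_neq_zero)
qed

context sigma01_model
begin

lemmas [definable_intros] = definable_Ex definable_All

lemma definable_dvd [definable_intros]:
  assumes "definable_tm f" "definable_tm g"
  shows "definable S (\<lambda>e. f e dvd g e)"
proof -
  have "definable S (\<lambda>e. e 0 dvd e 1)"
    unfolding dvd_def by (intro definable_intros)
  from definable_subst[OF this assms] show ?thesis .
qed

lemma definable_tm_modulus [definable_intros]:
  "definable_tm f \<Longrightarrow> definable_tm g \<Longrightarrow> definable_tm (\<lambda>e. modulus (f e) (g e))"
  unfolding modulus_def by (intro definable_intros)

lemma ex_common_multiple: "\<exists>b>0. \<forall>i<n. i + 1 dvd (b :: 'a)"
proof -
  have "definable S (\<lambda>e. \<exists>b>0. \<forall>i<e 0. i + 1 dvd b)" by (intro definable_intros)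
  then show ?thesis
  proof (induction n rule: bounded_induction)
    case 0
    show ?case by (intro exI[of _ 1]) simp
  next
    case (Suc n)
    then obtain b where b: "0 < b" "\<forall>i<n. i + 1 dvd b" by blast
    have "i + 1 dvd b * (n + 1)" if "i < n + 1" for i
      using that b(2) unfolding less_eq_iff_succ_less[symmetric] le_less by (auto intro: dvd_mult2)
    moreover have "0 < b * (n + 1)"
      using b(1) by (intro mult_pos_pos) (auto simp: zero_less_iff_neq_zero)
    ultimately show ?case by blast
  qed
qed

text \<open>
  The number \<open>a\<close> is the product of the moduli in question. The induction shows that the product
  over \<open>i < k\<close> can be cancelled modulo all other moduli.
\<close>

lemma ex_code:
  assumes "A \<in> S" and b: "\<And>i. i < N \<Longrightarrow> i + 1 dvd b" "0 < b"
  shows "\<exists>a>0. (\<forall>i<N. i \<in> A \<longrightarrow> modulus b i dvd a) \<and> (\<forall>j<N. j \<notin> A \<longrightarrow> \<not> modulus b j dvd a)"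
proof -
  have "definable S (\<lambda>e. e 0 \<le> N \<longrightarrow> (\<exists>a>0. (\<forall>i<e 0. i \<in> A \<longrightarrow> modulus b i dvd a) \<and>
      (\<forall>j<N. j \<notin> A \<longrightarrow> (\<forall>c. modulus b j dvd a * c \<longrightarrow> modulus b j dvd c))))"
    by (intro definable_intros \<open>A \<in> S\<close>)
  then have "k \<le> N \<longrightarrow> (\<exists>a>0. (\<forall>i<k. i \<in> A \<longrightarrow> modulus b i dvd a) \<and>
      (\<forall>j<N. j \<notin> A \<longrightarrow> (\<forall>c. modulus b j dvd a * c \<longrightarrow> modulus b j dvd c)))" for k
  proof (induction k rule: bounded_induction)
    case 0
    show ?case by (intro impI exI[of _ 1]) simp
  next
    case (Suc k)
    show ?case
    proof
      assume "k + 1 \<le> N"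
      then have "k < N" by (simp add: less_iff_succ_less_eq)
      then obtain a where a: "0 < a" "\<And>i. i < k \<Longrightarrow> i \<in> A \<Longrightarrow> modulus b i dvd a"
        "\<And>j c. j < N \<Longrightarrow> j \<notin> A \<Longrightarrow> modulus b j dvd a * c \<Longrightarrow> modulus b j dvd c"
        using Suc by auto
      define a' where "a' = (if k \<in> A then modulus b k * a else a)"
      have "0 < modulus b k" by (simp add: modulus_def zero_less_iff_neq_zero)
      then have "0 < a'" using a(1) by (auto simp: a'_def)
      moreover have "modulus b i dvd a'" if "i < k + 1" "i \<in> A" for i
        using that a(2) unfolding less_eq_iff_succ_less[symmetric] le_less a'_def by auto
      moreover have "modulus b j dvd c" if "j < N" "j \<notin> A" "modulus b j dvd a' * c" for j c
      proof (cases "k \<in> A")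
        case True
        then have "modulus b j dvd modulus b k * (a * c)"
          using that by (simp add: a'_def mult.assoc)
        have "modulus b j dvd a * c"
        proof (rule modulus_cancel)
          show "i + 1 dvd b" if "i < N" for i using b(1) that .
          show "k \<noteq> j" using True that by blast
        qed fact+
        then show ?thesis using a(3) that by blast
      next
        case False
        then show ?thesis using that a(3) unfolding a'_def by metis
      qed
      ultimately show "\<exists>a>0. (\<forall>i<k + 1. i \<in> A \<longrightarrow> modulus b i dvd a) \<and>
        (\<forall>j<N. j \<notin> A \<longrightarrow> (\<forall>c. modulus b j dvd a * c \<longrightarrow> modulus b j dvd c))"
        by (intro exI[of _ a'] conjI allI impI)
    qed
  qed
  from this[of N, THEN mp, OF order_refl] obtain a where a: "0 < a" "\<forall>i<N. i \<in> A \<longrightarrow> modulus b i dvd a"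
    "\<forall>j<N. j \<notin> A \<longrightarrow> (\<forall>c. modulus b j dvd a * c \<longrightarrow> modulus b j dvd c)" by blast
  have "\<not> modulus b j dvd a" if "j < N" "j \<notin> A" for j
  proof
    assume "modulus b j dvd a"
    then have "modulus b j dvd a * 1" by simp
    then have "modulus b j dvd 1" using a(3) that by blast
    then show False using modulus_not_dvd_one[OF b(2)] by blast
  qed
  then show ?thesis using a by blast
qed

lemma ex_division:
  fixes a d :: 'a
  assumes "0 < d"
  shows "\<exists>q t. a = d * q + t \<and> t < d"
proof -
  have "definable S (\<lambda>e. \<exists>q t. e 0 = d * q + t \<and> t < d)" by (intro definable_intros)
  then show ?thesis
  proof (induction a rule: bounded_induction)
    case 0
    show ?case using assms by (intro exI[of _ 0]) simp
  next
    case (Suc a)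
    then obtain q t where qt: "a = d * q + t" "t < d" by blast
    show ?case
    proof (cases "t + 1 = d")
      case True
      have "a + 1 = d * q + (t + 1)" using qt by (simp add: ac_simps)
      then have "a + 1 = d * (q + 1) + 0" unfolding True by (simp add: algebra_simps)
      then show ?thesis using assms by blast
    next
      case False
      moreover have "t + 1 \<le> d" using qt(2) by (simp add: less_iff_succ_less_eq)
      ultimately have "t + 1 < d" by simp
      then show ?thesis using qt by (intro exI[of _ q] exI[of _ "t + 1"]) (simp add: ac_simps)
    qed
  qed
qed

lemma collection:
  assumes "definable S (\<lambda>e. Q (e 0) (e 1))" "\<And>x. \<exists>y. Q x y"
  shows "\<exists>k. \<forall>x<n. \<exists>y\<le>k. Q x y"
proof -
  have "definable S (\<lambda>e. \<exists>k. \<forall>x<e 0. \<exists>y\<le>k. Q x y)"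
    by (intro definable_intros definable_subst[OF assms(1)])
  then show ?thesis
  proof (induction n rule: bounded_induction)
    case 0
    show ?case by simp
  next
    case (Suc n)
    then obtain k where k: "\<And>x. x < n \<Longrightarrow> \<exists>y\<le>k. Q x y" by blast
    obtain z where "Q n z" using assms(2) by blast
    have "\<exists>y\<le>max k z. Q x y" if "x < n + 1" for x
    proof (cases "x = n")
      case True
      then show ?thesis using \<open>Q n z\<close> by (intro exI[of _ z]) simp
    next
      case False
      moreover have "x \<le> n" using that by (simp flip: less_eq_iff_succ_less)
      ultimately have "x < n" by simp
      then obtain y where "y \<le> k" "Q x y" using k by blast
      then show ?thesis by (intro exI[of _ y]) (simp add: le_max_iff_disj)
    qed
    then show ?case by blast
  qed
qed

text \<open>
  Minimization turns a definable total relation into a function with definable graph.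
\<close>

lemma least_function:
  assumes def: "definable S (\<lambda>e. Q (e 0) (e 1))" and ex: "\<And>x. \<exists>y. Q x y"
  obtains F where "\<And>x. Q x (F x)" "\<And>x y. Q x y \<Longrightarrow> F x \<le> y" "definable S (\<lambda>e. F (e 0) = e 1)"
proof -
  note Q_intro = definable_subst[OF def]
  have "\<exists>y. Q x y \<and> (\<forall>z<y. \<not> Q x z)" for x
  proof -
    obtain y where "Q x y" using ex by blast
    moreover have "definable S (\<lambda>e. Q x (e 0))" by (intro Q_intro definable_intros)
    ultimately show ?thesis by (intro ex_least)
  qed
  then obtain F where F: "\<And>x. Q x (F x)" "\<And>x z. z < F x \<Longrightarrow> \<not> Q x z" by metis
  have le: "F x \<le> y" if "Q x y" for x y using F(2)[of y x] that by (auto simp: not_less[symmetric])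
  have eq: "F x = y \<longleftrightarrow> Q x y \<and> (\<forall>z<y. \<not> Q x z)" for x y
  proof
    assume "Q x y \<and> (\<forall>z<y. \<not> Q x z)"
    then show "F x = y" using F(1)[of x] le[of x y] by (auto simp: le_less)
  qed (use F in auto)
  show thesis
  proof (rule that[OF F(1) le])
    show "definable S (\<lambda>e. F (e 0) = e 1)"
      unfolding eq by (intro definable_intros Q_intro)
  qed
qed

text \<open>
  The code of \<open>x\<close> is \<open>rk x\<close>, the least common multiple of the moduli with index in the down-set
  of \<open>x\<close>. A larger down-set has more moduli and therefore a code that is at least as large;
  equality of codes forces equality of down-sets, hence of points.
\<close>

lemma omega_embeddable: "omega_embeddable S"
  unfolding omega_embeddable_def embeddable_def
proof (intro ballI impI, elim conjE)
  fix P L assume PL: "P \<in> S" "L \<in> S" and po: "partial_order_on P (rel_of L)"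
    and like: "omega_like (P, rel_of L)"
  define r where "r = rel_of L"
  have r: "r \<subseteq> P \<times> P" "\<And>x. x \<in> P \<Longrightarrow> (x, x) \<in> r" "antisym r" "trans r"
    using po unfolding r_def partial_order_on_def preorder_on_def refl_on_def by auto
  have r_intro: "definable S (\<lambda>e. (f e, g e) \<in> r)" if "definable_tm f" "definable_tm g" for f g
    unfolding r_def using that PL by (intro definable_intros)

  have N_ex: "\<exists>n. \<forall>i. (i, x) \<in> r \<longrightarrow> i < n" for x
  proof (cases "x \<in> P")
    case True
    then obtain m where m: "\<And>i. (i, x) \<in> r \<Longrightarrow> i \<noteq> x \<Longrightarrow> i < m"
      using like r(1) unfolding omega_like_def fin_def predecessors_def po_less_def r_def by fastforce
    have "i < max m (x + 1)" if "(i, x) \<in> r" for i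
      using m[OF that] less_add_one[of x] by (cases "i = x") (auto simp: less_max_iff_disj)
    then show ?thesis by blast
  qed (use r(1) in blast)
  have N_body: "definable S (\<lambda>e. \<forall>i. (i, e 0) \<in> r \<longrightarrow> i < e 1)"
    by (intro definable_intros r_intro)
  obtain N where N': "\<And>x. \<forall>i. (i, x) \<in> r \<longrightarrow> i < N x"
    and N_least: "\<And>x n. \<forall>i. (i, x) \<in> r \<longrightarrow> i < n \<Longrightarrow> N x \<le> n"
    and N_def': "definable S (\<lambda>e. N (e 0) = e 1)"
    by (rule least_function[OF N_body N_ex]) (rule that)
  have N: "i < N x" if "(i, x) \<in> r" for i x using N' that by blast
  note N_intro = definable_subst[OF N_def']

  have B_body: "definable S (\<lambda>e. 0 < e 1 \<and> (\<forall>i<e 0. i + 1 dvd e 1))" by (intro definable_intros)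
  obtain B where B: "\<And>n. 0 < B n \<and> (\<forall>i<n. i + 1 dvd B n)"
    and B_def': "definable S (\<lambda>e. B (e 0) = e 1)"
    by (rule least_function[OF B_body ex_common_multiple]) (rule that)
  note B_intro = definable_subst[OF B_def']

  have code: "\<exists>a>0. (\<forall>i<N x. (i, x) \<in> r \<longrightarrow> modulus (B (N x)) i dvd a) \<and>
      (\<forall>j<N x. (j, x) \<notin> r \<longrightarrow> \<not> modulus (B (N x)) j dvd a)" for x
  proof -
    have "{i. (i, x) \<in> r} \<in> S" by (intro bounded_comprehension r_intro definable_intros)
    then show ?thesis using ex_code[of "{i. (i, x) \<in> r}" "N x" "B (N x)"] B by simp
  qed

  define M where "M x a \<longleftrightarrow> 0 < a \<and> (\<forall>i. (i, x) \<in> r \<longrightarrow> modulus (B (N x)) i dvd a)" for x a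
  have M_ex: "\<exists>a. M x a" for x using code[of x] N unfolding M_def by blast
  have "M x a \<longleftrightarrow> 0 < a \<and> (\<forall>n. N x = n \<longrightarrow> (\<forall>b. B n = b \<longrightarrow>
      (\<forall>i. (i, x) \<in> r \<longrightarrow> modulus b i dvd a)))" for x a
    by (simp add: M_def)
  then have M_def': "definable S (\<lambda>e. M (e 0) (e 1))"
    by (simp only:) (intro definable_intros r_intro N_intro B_intro)
  obtain rk where rk: "\<And>x. M x (rk x)" and rk_least: "\<And>x a. M x a \<Longrightarrow> rk x \<le> a"
    and rk_def': "definable S (\<lambda>e. rk (e 0) = e 1)"
    by (rule least_function[OF M_def' M_ex]) (rule that)
  note rk_intro = definable_subst[OF rk_def']
  \<comment> \<open>The remainder modulo the least common multiple of any common multiple is a common multiple too.\<close>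
  have rk_dvd: "rk x dvd a" if "M x a" for x a
  proof -
    have "0 < rk x" using rk by (simp add: M_def)
    then obtain q t where qt: "a = rk x * q + t" "t < rk x" using ex_division by blast
    have "modulus (B (N x)) i dvd t" if "(i, x) \<in> r" for i
    proof -
      have "modulus (B (N x)) i dvd rk x * q" using rk that by (simp add: M_def)
      moreover have "modulus (B (N x)) i dvd rk x * q + t"
        using \<open>M x a\<close> that qt(1) by (simp add: M_def)
      ultimately show ?thesis by (simp add: dvd_add_right_iff)
    qed
    moreover have "\<not> M x t" using rk_least[of x t] qt(2) by (auto simp: not_less[symmetric])
    ultimately have "t = 0" by (simp add: M_def zero_less_iff_neq_zero)
    then show ?thesis using qt(1) by simp
  qed
  have rk_code: "(j, x) \<in> r \<longleftrightarrow> modulus (B (N x)) j dvd rk x" if "j < N x" for j x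
  proof
    assume "modulus (B (N x)) j dvd rk x"
    obtain a where "M x a" and "\<forall>j<N x. (j, x) \<notin> r \<longrightarrow> \<not> modulus (B (N x)) j dvd a"
      using code[of x] N unfolding M_def by blast
    then show "(j, x) \<in> r" using that rk_dvd \<open>modulus (B (N x)) j dvd rk x\<close> by (metis dvd_trans)
  qed (use rk in \<open>simp add: M_def\<close>)

  have R_ex: "\<exists>k. \<forall>x. x \<in> P \<and> N x \<le> n \<longrightarrow> rk x \<le> k" for n
  proof -
    obtain k where "\<forall>x<n. \<exists>a\<le>k. rk x = a" using collection[OF rk_def', of n] by auto
    moreover have "x < n" if "x \<in> P" "N x \<le> n" for x
      using N[OF r(2)[OF that(1)]] that(2) by simp
    ultimately show ?thesis by blast
  qed
  \<comment> \<open>The closure rules apply to the graphs of \<open>N\<close> and \<open>rk\<close>, so their values are named by quantifiers.\<close>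
  have R_eq: "(\<forall>x. x \<in> P \<and> N x \<le> n \<longrightarrow> rk x \<le> k) \<longleftrightarrow>
      (\<forall>x. x \<in> P \<longrightarrow> (\<forall>m. N x = m \<longrightarrow> m \<le> n \<longrightarrow> (\<forall>a. rk x = a \<longrightarrow> a \<le> k)))" for n k
    by blast
  have R_body: "definable S (\<lambda>e. \<forall>x. x \<in> P \<and> N x \<le> e 0 \<longrightarrow> rk x \<le> e 1)"
    unfolding R_eq by (intro definable_intros N_intro rk_intro PL)
  obtain R where R': "\<And>n. \<forall>x. x \<in> P \<and> N x \<le> n \<longrightarrow> rk x \<le> R n"
    and R_least: "\<And>n k. \<forall>x. x \<in> P \<and> N x \<le> n \<longrightarrow> rk x \<le> k \<Longrightarrow> R n \<le> k"
    and R_def': "definable S (\<lambda>e. R (e 0) = e 1)"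
    by (rule least_function[OF R_body R_ex]) (rule that)
  note R_intro = definable_subst[OF R_def']
  have R: "rk x \<le> R n" if "x \<in> P" "N x \<le> n" for x n using R' that by blast
  have R_mono: "R m \<le> R n" if "m \<le> n" for m n
    using that R by (intro R_least) (auto intro: order_trans)

  define h where "h x = N x * R (N x) + rk x" for x
  \<comment> \<open>The code is at most \<open>R (N x)\<close>, so that \<open>N x\<close> takes precedence in the comparison.\<close>
  have h_less: "h x < h y" if "x \<in> P" "y \<in> P" "N x < N y" for x y
  proof -
    have "h x \<le> N x * R (N x) + R (N x)" unfolding h_def using R that by simp
    also have "\<dots> = (N x + 1) * R (N x)" by (simp add: algebra_simps)
    also have "\<dots> \<le> N y * R (N y)"
      using that R_mono by (intro mult_mono) (auto simp flip: less_iff_succ_less_eq)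
    also have "\<dots> < h y" using rk[of y] by (simp add: h_def M_def)
    finally show ?thesis .
  qed
  show "embeds_into S (P, rel_of L) omega"
  proof (rule embeds_intoI)
    have "h x = v \<longleftrightarrow> (\<exists>n. N x = n \<and> (\<exists>k. R n = k \<and> (\<exists>a. rk x = a \<and> v = n * k + a)))" for x v
      by (auto simp: h_def)
    then show "definable S (\<lambda>e. e 0 \<in> P \<and> h (e 0) = e 1)"
      by (simp only:) (intro definable_intros N_intro R_intro rk_intro PL)
    show "inj_on h P"
    proof (rule inj_onI)
      fix x y assume xy: "x \<in> P" "y \<in> P" "h x = h y"
      then have "N x = N y" using h_less[of x y] h_less[of y x] by (cases "N x" "N y" rule: linorder_cases) auto
      moreover from this have "rk x = rk y" using xy(3) by (simp add: h_def)
      ultimately have "(j, x) \<in> r \<longleftrightarrow> (j, y) \<in> r" for j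
        using rk_code[of j x] rk_code[of j y] N by metis
      then have "(x, y) \<in> r" "(y, x) \<in> r" using r(2) xy by blast+
      then show "x = y" using antisymD[OF r(3)] by blast
    qed
    show "h x \<in> fst omega" for x by (simp add: omega_def)
    show "(h x, h y) \<in> snd omega" if xy: "(x, y) \<in> rel_of L" "x \<in> P" "y \<in> P" for x y
    proof -
      have sub: "(i, y) \<in> r" if "(i, x) \<in> r" for i
        using transD[OF r(4) that] xy(1) by (simp add: r_def)
      then have "N x \<le> N y" by (intro N_least) (use N in blast)
      moreover have "h x \<le> h y" if "N x = N y"
      proof -
        have "M x (rk y)" using rk[of y] sub that by (simp add: M_def)
        then show ?thesis using rk_least that by (simp add: h_def)
      qed
      ultimately have "h x \<le> h y" using h_less[OF xy(2,3)] by (metis le_less)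
      then show ?thesis by (simp add: omega_def)
    qed
  qed
qed

end

section \<open>Sums of orders\<close>

context rca0_model
begin

lemma embeds_into_restrict:
  assumes emb: "embeddable S like U" and PL: "P \<in> S" "L \<in> S" "partial_order_on P (rel_of L)"
    and V: "V \<in> S" "V \<subseteq> P" and like: "like (V, rel_of L \<inter> V \<times> V)"
  shows "embeds_into S (V, rel_of L \<inter> V \<times> V) U"
proof -
  let ?L = "pairs_of (\<lambda>x y. (x, y) \<in> rel_of L \<and> x \<in> V \<and> y \<in> V)"
  have "?L \<in> S" by (intro pairs_comprehension definable_intros PL V)
  moreover have L: "rel_of ?L = rel_of L \<inter> V \<times> V" by auto
  moreover have "partial_order_on V (rel_of L \<inter> V \<times> V)"
    unfolding partial_order_on_def preorder_on_def
  proof (intro conjI)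
    have L: "refl_on P (rel_of L)" "antisym (rel_of L)" "trans (rel_of L)"
      using PL(3) unfolding partial_order_on_def preorder_on_def by auto
    show "refl_on V (rel_of L \<inter> V \<times> V)" using L(1) V(2) by (auto simp: refl_on_def)
    show "antisym (rel_of L \<inter> V \<times> V)" by (rule antisymI) (use antisymD[OF L(2)] in blast)
    show "trans (rel_of L \<inter> V \<times> V)" by (rule transI) (use transD[OF L(3)] in blast)
  qed blast
  ultimately show ?thesis
    using emb[unfolded embeddable_def, rule_format, of V ?L] V(1) like by simp
qed

text \<open>
  Order preservation could fail only for a pair that leads from outside \<open>V\<close> into \<open>V\<close>; there is none
  because \<open>V\<close> is downward closed.
\<close>

lemma embeds_into_po_sum:
  assumes V: "V \<in> S" "V \<subseteq> P" "P \<in> S"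
    and emb: "embeds_into S (V, r \<inter> V \<times> V) T\<^sub>0" "embeds_into S (P - V, r \<inter> (P - V) \<times> (P - V)) T\<^sub>1"
    and down: "\<And>x y. (x, y) \<in> r \<Longrightarrow> x \<in> P \<Longrightarrow> y \<in> V \<Longrightarrow> x \<in> V"
  shows "embeds_into S (P, r) (po_sum T\<^sub>0 T\<^sub>1)"
proof -
  obtain f where f: "definable S (\<lambda>e. e 0 \<in> V \<and> f (e 0) = e 1)" "inj_on f V"
    "\<And>x. x \<in> V \<Longrightarrow> f x \<in> fst T\<^sub>0"
    "\<And>x y. (x, y) \<in> r \<inter> V \<times> V \<Longrightarrow> x \<in> V \<Longrightarrow> y \<in> V \<Longrightarrow> (f x, f y) \<in> snd T\<^sub>0"
    using emb(1) by (rule embeds_intoE) (rule that)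
  obtain g where g: "definable S (\<lambda>e. e 0 \<in> P - V \<and> g (e 0) = e 1)" "inj_on g (P - V)"
    "\<And>x. x \<in> P - V \<Longrightarrow> g x \<in> fst T\<^sub>1"
    "\<And>x y. (x, y) \<in> r \<inter> (P - V) \<times> (P - V) \<Longrightarrow> x \<in> P - V \<Longrightarrow> y \<in> P - V \<Longrightarrow> (g x, g y) \<in> snd T\<^sub>1"
    using emb(2) by (rule embeds_intoE) (rule that)
  define h where "h x = (if x \<in> V then cpair 0 (f x) else cpair 1 (g x))" for x
  have h_eq: "x \<in> P \<and> h x = v \<longleftrightarrow> (\<exists>u\<le>v. v = cpair 0 u \<and> (x \<in> V \<and> f x = u)) \<or>
      (\<exists>u\<le>v. v = cpair 1 u \<and> (x \<in> P - V \<and> g x = u))" for x v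
    using V(2) by (auto simp: h_def cpair_ge)
  show ?thesis
  proof (rule embeds_intoI)
    show "definable S (\<lambda>e. e 0 \<in> P \<and> h (e 0) = e 1)"
      unfolding h_eq by (intro definable_intros definable_subst[OF f(1)] definable_subst[OF g(1)])
    show "inj_on h P"
      using f(2) g(2) unfolding inj_on_def h_def by auto
    show "h x \<in> fst (po_sum T\<^sub>0 T\<^sub>1)" if "x \<in> P" for x
      using f(3) g(3) that by (auto simp: po_sum_def h_def)
    show "(h x, h y) \<in> snd (po_sum T\<^sub>0 T\<^sub>1)" if "(x, y) \<in> r" "x \<in> P" "y \<in> P" for x y
      using f(3,4) g(3,4) down that by (auto simp: po_sum_def h_def)
  qed
qed

end

lemma fin_subset: "fin B \<Longrightarrow> A \<subseteq> B \<Longrightarrow> fin A"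
  unfolding fin_def by blast

context sigma01_model
begin

lemma omega_star_embeddable: "omega_star_embeddable S"
  using omega_embeddable omega_embeddable_iff_omega_star_embeddable by blast

text \<open>
  The points with finitely many predecessors form an initial part of type \<open>\<omega>\<close>; all others have
  finitely many successors.
\<close>

lemma omega_plus_omega_star_embeddable: "omega_plus_omega_star_embeddable S"
  unfolding omega_plus_omega_star_embeddable_def embeddable_def
proof (intro ballI impI, elim conjE)
  fix P L assume PL: "P \<in> S" "L \<in> S" and po: "partial_order_on P (rel_of L)"
    and like: "omega_plus_omega_star_like (P, rel_of L)"
  define r where "r = rel_of L"
  have r: "r \<subseteq> P \<times> P" "antisym r" "trans r"
    using po unfolding r_def partial_order_on_def preorder_on_def by auto
  define V where "V = {x. x \<in> P \<and> (\<exists>m. \<forall>y. (y, x) \<in> rel_of L \<longrightarrow> y = x \<or> y < m)}"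
  have "V \<in> S" unfolding V_def by (intro bounded_comprehension definable_intros PL)
  have "P - V \<in> S" using bounded_comprehension[OF definable_Conj[OF
        definable_Mem[OF definable_tm_Var PL(1), of 0] definable_Neg[OF definable_Mem[OF definable_tm_Var \<open>V \<in> S\<close>, of 0]]]]
    by (simp add: set_diff_eq)
  have V: "x \<in> V \<longleftrightarrow> x \<in> P \<and> fin (predecessors (P, r) x)" for x
    using r(1) unfolding V_def fin_def predecessors_def po_less_def r_def by auto
  have part0: "omega_like (V, r \<inter> V \<times> V)"
    unfolding omega_like_def
  proof
    fix x assume "x \<in> fst (V, r \<inter> V \<times> V)"
    then have "fin (predecessors (P, r) x)" using V by simp
    then show "fin (predecessors (V, r \<inter> V \<times> V) x)"
      by (rule fin_subset) (auto simp: predecessors_def po_less_def V)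
  qed
  have part1: "omega_star_like (P - V, r \<inter> (P - V) \<times> (P - V))"
    unfolding omega_star_like_def
  proof
    fix x assume "x \<in> fst (P - V, r \<inter> (P - V) \<times> (P - V))"
    then have "fin (successors (P, r) x)"
      using V like unfolding omega_plus_omega_star_like_def r_def by auto
    then show "fin (successors (P - V, r \<inter> (P - V) \<times> (P - V)) x)"
      by (rule fin_subset) (auto simp: successors_def po_less_def)
  qed
  have initial: "x \<in> V" if "(x, y) \<in> r" "x \<in> P" "y \<in> V" for x y
  proof -
    have "predecessors (P, r) x \<subseteq> predecessors (P, r) y"
    proof
      fix z assume "z \<in> predecessors (P, r) x"
      then have z: "z \<in> P" "(z, x) \<in> r" "z \<noteq> x" by (auto simp: predecessors_def po_less_def)
      have "(z, y) \<in> r" using z(2) that(1) by (rule transD[OF r(3)])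
      moreover have "z \<noteq> y" using z(2,3) that(1) antisymD[OF r(2)] by blast
      ultimately show "z \<in> predecessors (P, r) y"
        using z(1) that(3) V by (simp add: predecessors_def po_less_def)
    qed
    moreover have "fin (predecessors (P, r) y)" using V[of y] that(3) by blast
    ultimately have "fin (predecessors (P, r) x)" by (rule fin_subset[rotated])
    then show ?thesis using V[of x] that(2) by blast
  qed
  show "embeds_into S (P, rel_of L) omega_plus_omega_star"
    unfolding omega_plus_omega_star_def
  proof (rule embeds_into_po_sum)
    show "embeds_into S (V, rel_of L \<inter> V \<times> V) omega"
      using part0 unfolding r_def
      by (intro embeds_into_restrict[OF omega_embeddable[unfolded omega_embeddable_def] PL po \<open>V \<in> S\<close>]) (auto simp: V)
    show "embeds_into S (P - V, rel_of L \<inter> (P - V) \<times> (P - V)) omega_star"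
      using part1 unfolding r_def
      by (intro embeds_into_restrict[OF omega_star_embeddable[unfolded omega_star_embeddable_def] PL po \<open>P - V \<in> S\<close>]) auto
    show "x \<in> V" if "(x, y) \<in> rel_of L" "x \<in> P" "y \<in> V" for x y
      using initial that unfolding r_def by blast
  qed (use \<open>V \<in> S\<close> PL V in auto)
qed

text \<open>
  Let \<open>V\<close> consist of those \<open>x\<close> that have a number \<open>v\<close> above them in the order which is smaller than
  every number below them. If \<open>y\<close> in \<open>V\<close> lies above \<open>x\<close>, then its \<open>v\<close> is smaller than the number \<open>x\<close>,
  so \<open>y\<close> lies in one of the finitely many finite intervals from \<open>x\<close> to a point \<open>v < x\<close>. Dually, if \<open>y\<close>
  outside \<open>V\<close> lies below \<open>x\<close>, then \<open>y\<close> is in an interval from a point \<open>z \<le> x\<close> to \<open>x\<close>. Thus \<open>V\<close> is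
  \<open>\<omega>\<^sup>*\<close>-like and its complement is \<open>\<omega>\<close>-like.
\<close>

lemma zeta_embeddable: "zeta_embeddable S"
  unfolding zeta_embeddable_def embeddable_def
proof (intro ballI impI, elim conjE)
  fix P L assume PL: "P \<in> S" "L \<in> S" and po: "partial_order_on P (rel_of L)"
    and like: "zeta_like (P, rel_of L)"
  define r where "r = rel_of L"
  have r: "r \<subseteq> P \<times> P" "\<And>x. x \<in> P \<Longrightarrow> (x, x) \<in> r" "antisym r" "trans r"
    using po unfolding r_def partial_order_on_def preorder_on_def refl_on_def by auto
  define V where "V = {x. x \<in> P \<and> (\<exists>v. (x, v) \<in> rel_of L \<and> (\<forall>z\<le>v. (z, x) \<notin> rel_of L))}"
  have "V \<in> S" unfolding V_def by (intro bounded_comprehension definable_intros PL)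
  have "P - V \<in> S" using bounded_comprehension[OF definable_Conj[OF
        definable_Mem[OF definable_tm_Var PL(1), of 0] definable_Neg[OF definable_Mem[OF definable_tm_Var \<open>V \<in> S\<close>, of 0]]]]
    by (simp add: set_diff_eq)
  have V: "x \<in> V \<longleftrightarrow> x \<in> P \<and> (\<exists>v. (x, v) \<in> r \<and> (\<forall>z\<le>v. (z, x) \<notin> r))" for x
    unfolding V_def r_def by simp
  have between: "\<exists>k. \<forall>y. (z, y) \<in> r \<and> (y, x) \<in> r \<and> y \<noteq> z \<and> y \<noteq> x \<longrightarrow> y < k" for z x
  proof (cases "z \<in> P \<and> x \<in> P")
    case True
    then have "fin {y. po_less (P, r) z y \<and> po_less (P, r) y x}"
      using like unfolding zeta_like_def r_def by simp
    then show ?thesis using r(1) unfolding fin_def po_less_def by auto blast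
  qed (use r(1) in blast)
  have up: "fin {y. \<exists>z\<le>x. (z, y) \<in> r \<and> (y, x) \<in> r \<and> y \<noteq> x}" for x
  proof -
    have "\<exists>k. \<forall>z<x + 1. \<exists>m\<le>k. \<forall>y. (z, y) \<in> r \<and> (y, x) \<in> r \<and> y \<noteq> z \<and> y \<noteq> x \<longrightarrow> y < m"
      by (rule collection[OF _ between]) (unfold r_def, intro definable_intros PL)
    then obtain k where k: "\<And>z y. z \<le> x \<Longrightarrow> (z, y) \<in> r \<Longrightarrow> (y, x) \<in> r \<Longrightarrow> y \<noteq> z \<Longrightarrow> y \<noteq> x \<Longrightarrow> y < k"
      unfolding less_eq_iff_succ_less[symmetric] by (meson order_less_le_trans)
    have "y < max k (x + 1)" if "z \<le> x" "(z, y) \<in> r" "(y, x) \<in> r" "y \<noteq> x" for y z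
      using k[OF that(1-3) _ that(4)] that(1) less_eq_iff_succ_less[of z x]
      by (cases "y = z") (auto simp: less_max_iff_disj)
    then show ?thesis unfolding fin_def by blast
  qed
  have down: "fin {y. \<exists>z\<le>x. (x, y) \<in> r \<and> (y, z) \<in> r \<and> y \<noteq> x}" for x
  proof -
    have "\<exists>k. \<forall>z<x + 1. \<exists>m\<le>k. \<forall>y. (x, y) \<in> r \<and> (y, z) \<in> r \<and> y \<noteq> x \<and> y \<noteq> z \<longrightarrow> y < m"
      by (rule collection[OF _ between]) (unfold r_def, intro definable_intros PL)
    then obtain k where k: "\<And>z y. z \<le> x \<Longrightarrow> (x, y) \<in> r \<Longrightarrow> (y, z) \<in> r \<Longrightarrow> y \<noteq> x \<Longrightarrow> y \<noteq> z \<Longrightarrow> y < k"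
      unfolding less_eq_iff_succ_less[symmetric] by (meson order_less_le_trans)
    have "y < max k (x + 1)" if "z \<le> x" "(x, y) \<in> r" "(y, z) \<in> r" "y \<noteq> x" for y z
      using k[OF that(1-4)] that(1) less_eq_iff_succ_less[of z x]
      by (cases "y = z") (auto simp: less_max_iff_disj)
    then show ?thesis unfolding fin_def by blast
  qed
  have part0: "omega_star_like (V, r \<inter> V \<times> V)"
    unfolding omega_star_like_def
  proof
    fix x
    have "\<exists>z\<le>x. (x, y) \<in> r \<and> (y, z) \<in> r \<and> y \<noteq> x" if y: "y \<in> V" "(x, y) \<in> r" "y \<noteq> x" for y
    proof -
      obtain v where v: "(y, v) \<in> r" "\<forall>z\<le>v. (z, y) \<notin> r" using y(1) unfolding V by blast
      then have "v \<le> x" using y(2) linear[of v x] by blast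
      then show ?thesis using v(1) y(2,3) by (intro exI[of _ v]) simp
    qed
    then show "fin (successors (V, r \<inter> V \<times> V) x)"
      by (intro fin_subset[OF down[of x]]) (auto simp: successors_def po_less_def)
  qed
  have part1: "omega_like (P - V, r \<inter> (P - V) \<times> (P - V))"
    unfolding omega_like_def
  proof
    fix x
    have "\<exists>z\<le>x. (z, y) \<in> r \<and> (y, x) \<in> r \<and> y \<noteq> x" if "y \<in> P - V" "(y, x) \<in> r" "y \<noteq> x" for y
    proof -
      have "\<not> (\<forall>z\<le>x. (z, y) \<notin> r)" using that(1,2) V[of y] by blast
      then show ?thesis using that(2,3) by blast
    qed
    then show "fin (predecessors (P - V, r \<inter> (P - V) \<times> (P - V)) x)"
      by (intro fin_subset[OF up[of x]]) (auto simp: predecessors_def po_less_def)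
  qed
  have initial: "x \<in> V" if "(x, y) \<in> r" "x \<in> P" "y \<in> V" for x y
    using that transD[OF r(4)] unfolding V by blast
  show "embeds_into S (P, rel_of L) zeta"
    unfolding zeta_def
  proof (rule embeds_into_po_sum)
    show "embeds_into S (V, rel_of L \<inter> V \<times> V) omega_star"
      using part0 unfolding r_def
      by (intro embeds_into_restrict[OF omega_star_embeddable[unfolded omega_star_embeddable_def] PL po \<open>V \<in> S\<close>]) (auto simp: V)
    show "embeds_into S (P - V, rel_of L \<inter> (P - V) \<times> (P - V)) omega"
      using part1 unfolding r_def
      by (intro embeds_into_restrict[OF omega_embeddable[unfolded omega_embeddable_def] PL po \<open>P - V \<in> S\<close>]) auto
    show "x \<in> V" if "(x, y) \<in> rel_of L" "x \<in> P" "y \<in> V" for x y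
      using initial that unfolding r_def by blast
  qed (use \<open>V \<in> S\<close> PL V in auto)
qed

end

theorem theorem4p1:
  fixes S :: "'a::discretely_ordered_semiring set set"
  assumes "RCA0 S"
  shows "(ACA0 S \<longleftrightarrow> omega_embeddable S) \<and>
    (omega_embeddable S \<longleftrightarrow> omega_star_embeddable S) \<and>
    (omega_star_embeddable S \<longleftrightarrow> zeta_embeddable S) \<and>
    (zeta_embeddable S \<longleftrightarrow> omega_plus_omega_star_embeddable S)"
proof -
  interpret rca0_model S using assms by unfold_locales
  have "ACA0 S" if "omega_embeddable S"
    unfolding ACA0_iff_sigma01_model
    by unfold_locales (rule Sigma01_comprehension_if_omega_embeddable[OF that])
  moreover have "omega_embeddable S \<and> zeta_embeddable S \<and> omega_plus_omega_star_embeddable S" if "ACA0 S"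
  proof -
    interpret sigma01_model S using that unfolding ACA0_iff_sigma01_model .
    show ?thesis
      using omega_embeddable zeta_embeddable omega_plus_omega_star_embeddable by blast
  qed
  ultimately show ?thesis
    using omega_embeddable_iff_omega_star_embeddable omega_embeddable_if_zeta_embeddable
      omega_embeddable_if_omega_plus_omega_star_embeddable by blast
qed

end
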